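(* Let $p>2$ be a prime and let $\mathbb H=\overline{\mathbb F_p}((t^{\mathbb Q}))$ with its $t$-adic valuation $v$. Let $K$ be a subfield of $\mathbb H$ containing $\overline{\mathbb F_p}(t)$ which is perfect, Henselian (with respect to $v$) and has no finite limits. Let $\alpha,\theta\in\mathbb H$ satisfy $\alpha^p-\alpha=t^{-1}$ and $\theta^p-\theta=\alpha$, and let $M_0=K(\theta)$. Then the (Galois) extension $(M_0/K,v)$ admits only one ramification ideal, and it is the maximal ideal of the valuation ring of $(M_0,v)$.
   Context: $\mathbb H$ is the Hahn series field with exponents in $\mathbb Q$ and coefficients in $\overline{\mathbb F_p}$ (well-ordered supports). A subfield $K$ of $\mathbb H$ has no finite limits if for every $a=\sum_\gamma c_\gamma t^\gamma\in K$ and every $\delta\in\mathbb R$ the set $\{\gamma<\delta\mid c_\gamma\ne0\}$ is finite. For a finite Galois extension $\mathcal E=(L/K,v)$ and $\sigma\in\mathrm{Gal}(L/K)$, $I_\sigma=\{c\in L\mid vc\ge v\left(\frac{\sigma b-b}{b}\right)\text{ for some }b\in L^*\}$; for a subgroup $H$ of $\mathrm{Gal}(L/K)$, $I_H=\bigcup_{\sigma\in H}I_\sigma$; $\mathrm{Ram}(\mathcal E)=\{I_H\mid H\text{ a subgroup of }\mathrm{Gal}(L/K),\ H\ne\{\mathrm{id}\}\}$. The ramification ideals of $\mathcal E$ are the elements of $\mathrm{Ram}(\mathcal E)$ contained in the maximal ideal $\mathcal M_L$ of the valuation ring of $(L,v)$. It is known that $M_0/K$ is Galois. *)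

theory Defs
  imports
    "HOL-Algebra.Algebraic_Closure_Type"
    "HOL-Algebra.Generated_Fields"
    "HOL-Algebra.Bij"
    "HOL-Library.Extended"
    "Berlekamp_Zassenhaus.Finite_Field"
begin

section \<open>Well-ordered sets of rationals\<close>

abbreviation well_ordered :: "rat set \<Rightarrow> bool" where
  "well_ordered A \<equiv> wfp_on A (<)"

lemma well_ordered_iff:
  "well_ordered A \<longleftrightarrow> (\<forall>S\<subseteq>A. S \<noteq> {} \<longrightarrow> (\<exists>m\<in>S. \<forall>x\<in>S. m \<le> x))"
proof -
  have "(\<forall>y. y < m \<longrightarrow> y \<notin> S) \<longleftrightarrow> (\<forall>x\<in>S. m \<le> x)" for m :: rat and S
    by (meson not_le)
  then show ?thesis unfolding wfp_on_iff_ex_minimal by simp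
qed

lemma well_orderedE:
  assumes "well_ordered A" "S \<subseteq> A" "S \<noteq> {}"
  obtains m where "m \<in> S" "\<And>x. x \<in> S \<Longrightarrow> m \<le> x"
  using assms(1)[unfolded well_ordered_iff, rule_format, OF assms(2,3)] that by blast

lemma well_ordered_Un:
  assumes "well_ordered A" "well_ordered B"
  shows "well_ordered (A \<union> B)"
  unfolding well_ordered_iff
proof (intro allI impI)
  fix S assume S: "S \<subseteq> A \<union> B" "S \<noteq> {}"
  show "\<exists>m\<in>S. \<forall>x\<in>S. m \<le> x"
  proof (cases "S \<inter> A = {} \<or> S \<inter> B = {}")
    case True
    then have "S \<subseteq> A \<or> S \<subseteq> B" using S by blast
    then show ?thesis
    proof
      assume "S \<subseteq> A"
      then show ?thesis using assms(1)[unfolded well_ordered_iff, rule_format] S(2) by simp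
    next
      assume "S \<subseteq> B"
      then show ?thesis using assms(2)[unfolded well_ordered_iff, rule_format] S(2) by simp
    qed
  next
    case False
    obtain m where m: "m \<in> S \<inter> A" "\<And>x. x \<in> S \<inter> A \<Longrightarrow> m \<le> x"
      using False assms(1) by (elim well_orderedE[where S = "S \<inter> A"]) auto
    obtain n where n: "n \<in> S \<inter> B" "\<And>x. x \<in> S \<inter> B \<Longrightarrow> n \<le> x"
      using False assms(2) by (elim well_orderedE[where S = "S \<inter> B"]) auto
    show ?thesis
    proof (rule bexI[of _ "min m n"])
      show "\<forall>x\<in>S. min m n \<le> x"
        using m n S by (metis Int_iff UnE min.coboundedI1 min.coboundedI2 subsetD)
      show "min m n \<in> S" using m n by (simp add: min_def)
    qed
  qed
qed

lemma well_ordered_empty: "well_ordered {}"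
  by (auto simp: well_ordered_iff)

lemma well_ordered_finite: "finite A \<Longrightarrow> well_ordered A"
  unfolding well_ordered_iff
  by (metis Min_in Min_le finite_subset)

lemma well_ordered_UN:
  assumes "finite I" "\<And>i. i \<in> I \<Longrightarrow> well_ordered (A i)"
  shows "well_ordered (\<Union>i\<in>I. A i)"
  using assms by (induction I) (auto simp: well_ordered_empty intro: well_ordered_Un)

lemma well_ordered_sumset:
  assumes A: "well_ordered A" and B: "well_ordered B"
  shows "well_ordered {a + b | a b. a \<in> A \<and> b \<in> B}"
  unfolding well_ordered_iff
proof (intro allI impI)
  fix S assume S: "S \<subseteq> {a + b | a b. a \<in> A \<and> b \<in> B}" "S \<noteq> {}"
  have step: "\<exists>a\<in>A. \<exists>b\<in>B. a + b \<in> T \<and> (\<forall>a'\<in>A. \<forall>b'\<in>B. a' + b' \<in> T \<longrightarrow> a \<le> a')"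
    if T: "T \<subseteq> S" "T \<noteq> {}" for T
  proof -
    have "{a \<in> A. \<exists>b\<in>B. a + b \<in> T} \<noteq> {}" using S T by blast
    then obtain a where "a \<in> {a \<in> A. \<exists>b\<in>B. a + b \<in> T}"
      "\<And>x. x \<in> {a \<in> A. \<exists>b\<in>B. a + b \<in> T} \<Longrightarrow> a \<le> x"
      using A by (elim well_orderedE[where S = "{a \<in> A. \<exists>b\<in>B. a + b \<in> T}"]) auto
    then show ?thesis by blast
  qed
  have claim: "\<forall>s\<in>S. (\<forall>a'\<in>A. \<forall>b'\<in>B. a' + b' \<in> S \<and> a' + b' < s \<longrightarrow> b' < b) \<longrightarrow> (\<exists>m\<in>S. \<forall>x\<in>S. m \<le> x)"
    if "b \<in> B" for b
    using B that
  proof (induction b rule: wfp_on_induct)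
    case (less b)
    show ?case
    proof (intro ballI impI)
      fix s assume s: "s \<in> S" "\<forall>a'\<in>A. \<forall>b'\<in>B. a' + b' \<in> S \<and> a' + b' < s \<longrightarrow> b' < b"
      show "\<exists>m\<in>S. \<forall>x\<in>S. m \<le> x"
      proof (cases "{t \<in> S. t < s} = {}")
        case True
        then show ?thesis using s(1) by (metis (mono_tags, lifting) empty_iff mem_Collect_eq not_le)
      next
        case False
        then obtain a1 b1 where ab: "a1 \<in> A" "b1 \<in> B" "a1 + b1 \<in> S" "a1 + b1 < s"
          "\<forall>a'\<in>A. \<forall>b'\<in>B. a' + b' \<in> S \<and> a' + b' < s \<longrightarrow> a1 \<le> a'"
          using step[of "{t \<in> S. t < s}"] by auto
        have "b1 < b" using ab s(2) by blast
        moreover have "b' < b1" if "a' \<in> A" "b' \<in> B" "a' + b' \<in> S" "a' + b' < a1 + b1" for a' b'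
        proof -
          have "a1 \<le> a'" using that ab(4,5) by force
          then show ?thesis using that(4) by linarith
        qed
        ultimately show ?thesis using less.IH[of b1] ab by blast
      qed
    qed
  qed (use that in simp)
  obtain a0 b0 where ab: "a0 \<in> A" "b0 \<in> B" "a0 + b0 \<in> S"
    "\<forall>a'\<in>A. \<forall>b'\<in>B. a' + b' \<in> S \<longrightarrow> a0 \<le> a'"
    using step[of S] S by blast
  have "b' < b0" if "a' \<in> A" "b' \<in> B" "a' + b' \<in> S" "a' + b' < a0 + b0" for a' b'
  proof -
    have "a0 \<le> a'" using that ab(4) by blast
    then show ?thesis using that(4) by linarith
  qed
  then show "\<exists>m\<in>S. \<forall>x\<in>S. m \<le> x" using claim[OF ab(2)] ab(3) by blast
qed

lemma well_ordered_finite_pairs: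
  assumes A: "well_ordered A" and B: "well_ordered B"
  shows "finite {a \<in> A. g - a \<in> B}"
proof -
  define P where "P = {a \<in> A. g - a \<in> B}"
  define Q where "Q = {x \<in> P. finite {y \<in> P. y < x}}"
  have PA: "P \<subseteq> A" by (auto simp: P_def)
  show ?thesis
  proof (cases "P = {}")
    case False
    obtain m0 where m0: "m0 \<in> P" "\<And>x. x \<in> P \<Longrightarrow> m0 \<le> x"
      using A PA False by (elim well_orderedE) auto
    then have "{y \<in> P. y < m0} = {}" by force
    then have "m0 \<in> Q" using m0(1) unfolding Q_def by (metis (lifting) finite.emptyI mem_Collect_eq)
    then have "(\<lambda>a. g - a) ` Q \<noteq> {}" by blast
    moreover have "(\<lambda>a. g - a) ` Q \<subseteq> B" by (auto simp: P_def Q_def)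
    ultimately have "\<exists>n\<in>(\<lambda>a. g - a) ` Q. \<forall>x\<in>(\<lambda>a. g - a) ` Q. n \<le> x"
      by (intro B[unfolded well_ordered_iff, rule_format])
    then obtain n where n: "n \<in> (\<lambda>a. g - a) ` Q" "\<And>x. x \<in> (\<lambda>a. g - a) ` Q \<Longrightarrow> n \<le> x"
      by blast
    then obtain m where m: "m \<in> Q" "n = g - m" by blast
    have mmax: "x \<le> m" if "x \<in> Q" for x using n(2)[of "g - x"] that m(2) by simp
    have fin: "finite {y \<in> P. y \<le> m}"
    proof -
      have "{y \<in> P. y \<le> m} \<subseteq> insert m {y \<in> P. y < m}" by auto
      then show ?thesis using m(1) by (simp add: Q_def finite_subset)
    qed
    have "{y \<in> P. m < y} = {}"
    proof (rule ccontr)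
      assume ne: "{y \<in> P. m < y} \<noteq> {}"
      obtain k where k: "k \<in> {y \<in> P. m < y}" "\<And>x. x \<in> {y \<in> P. m < y} \<Longrightarrow> k \<le> x"
        using A PA ne by (elim well_orderedE[where S = "{y \<in> P. m < y}"]) auto
      have "{y \<in> P. y < k} \<subseteq> {y \<in> P. y \<le> m}" using k(2) by force
      then have "k \<in> Q" using fin k(1) by (auto simp: Q_def intro: finite_subset)
      then show False using mmax[of k] k(1) by auto
    qed
    then have "P = {y \<in> P. y \<le> m}" by force
    then show ?thesis using fin P_def by simp
  next
    case True
    then show ?thesis unfolding P_def by (metis finite.emptyI)
  qed
qed

section \<open>The Hahn series field with rational exponents\<close>

typedef (overloaded) 'a hahn = "{f :: rat \<Rightarrow> 'a::zero. well_ordered {q. f q \<noteq> 0}}"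
  morphisms hahn_coeff Abs_hahn
  by (rule exI[of _ "\<lambda>_. 0"]) (simp add: well_ordered_empty)

setup_lifting type_definition_hahn

lemma hahn_eqI: "(\<And>q. hahn_coeff x q = hahn_coeff y q) \<Longrightarrow> x = y"
  by (metis ext hahn_coeff_inject)

lemma well_ordered_supp: "well_ordered {q. hahn_coeff x q \<noteq> 0}"
  using hahn_coeff[of x] by simp

lemma finite_hahn_pairs:
  "finite {a. hahn_coeff x a \<noteq> 0 \<and> hahn_coeff y (g - a) \<noteq> 0}"
  using well_ordered_finite_pairs[OF well_ordered_supp[of x] well_ordered_supp[of y], of g] by simp

instantiation hahn :: (zero) zero
begin
lift_definition zero_hahn :: "'a hahn" is "\<lambda>_. 0"
  by (simp add: well_ordered_empty)
instance ..
end

lift_definition hahn_monom :: "'a::zero \<Rightarrow> rat \<Rightarrow> 'a hahn" is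
  "\<lambda>c g q. if q = g then c else 0"
  by (rule well_ordered_finite) simp

instantiation hahn :: (zero_neq_one) one
begin
definition one_hahn :: "'a hahn" where "one_hahn = hahn_monom 1 0"
instance ..
end

instantiation hahn :: (ab_group_add) ab_group_add
begin
lift_definition plus_hahn :: "'a hahn \<Rightarrow> 'a hahn \<Rightarrow> 'a hahn" is "\<lambda>f g q. f q + g q"
  by (rule wfp_on_subset[OF well_ordered_Un], assumption, assumption) auto
lift_definition uminus_hahn :: "'a hahn \<Rightarrow> 'a hahn" is "\<lambda>f q. - f q"
  by simp
lift_definition minus_hahn :: "'a hahn \<Rightarrow> 'a hahn \<Rightarrow> 'a hahn" is "\<lambda>f g q. f q - g q"
  by (rule wfp_on_subset[OF well_ordered_Un], assumption, assumption) auto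
instance
  by standard (transfer; simp add: fun_eq_iff algebra_simps)+
end

text \<open>The Cauchy product; the index set of the sum is finite by \<open>finite_hahn_pairs\<close>, because the
  supports are well-ordered.\<close>

instantiation hahn :: (comm_ring_1) times
begin
lift_definition times_hahn :: "'a hahn \<Rightarrow> 'a hahn \<Rightarrow> 'a hahn" is
  "\<lambda>f g q. \<Sum>a | f a \<noteq> 0 \<and> g (q - a) \<noteq> 0. f a * g (q - a)"
proof -
  fix f g :: "rat \<Rightarrow> 'a"
  assume fg: "well_ordered {q. f q \<noteq> 0}" "well_ordered {q. g q \<noteq> 0}"
  show "well_ordered {q. (\<Sum>a | f a \<noteq> 0 \<and> g (q - a) \<noteq> 0. f a * g (q - a)) \<noteq> 0}"
  proof (rule wfp_on_subset[OF well_ordered_sumset[OF fg]], clarify)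
    fix q assume "(\<Sum>a | f a \<noteq> 0 \<and> g (q - a) \<noteq> 0. f a * g (q - a)) \<noteq> 0"
    then obtain a where "f a \<noteq> 0" "g (q - a) \<noteq> 0"
      by (elim sum.not_neutral_contains_not_neutral) auto
    then show "\<exists>a b. q = a + b \<and> a \<in> {q. f q \<noteq> 0} \<and> b \<in> {q. g q \<noteq> 0}"
      by (intro exI[of _ a] exI[of _ "q - a"]) simp
  qed
qed
instance ..
end

lemma hahn_coeff_mult:
  assumes "finite A" "{a. hahn_coeff x a \<noteq> 0 \<and> hahn_coeff y (q - a) \<noteq> 0} \<subseteq> A"
  shows "hahn_coeff (x * y) q = (\<Sum>a\<in>A. hahn_coeff x a * hahn_coeff y (q - a))"
  unfolding times_hahn.rep_eq by (rule sum.mono_neutral_left) (use assms in auto)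

lemma hahn_mult_commute: "x * y = y * (x :: 'a::comm_ring_1 hahn)"
proof (rule hahn_eqI)
  fix q
  show "hahn_coeff (x * y) q = hahn_coeff (y * x) q"
    unfolding times_hahn.rep_eq
    by (rule sum.reindex_bij_witness[of _ "\<lambda>a. q - a" "\<lambda>a. q - a"]) (auto simp: mult.commute)
qed

lemma hahn_distrib: "(x + y) * z = x * z + y * (z :: 'a::comm_ring_1 hahn)"
proof (rule hahn_eqI)
  fix q
  let ?A = "{a. hahn_coeff x a \<noteq> 0 \<and> hahn_coeff z (q - a) \<noteq> 0} \<union>
            {a. hahn_coeff y a \<noteq> 0 \<and> hahn_coeff z (q - a) \<noteq> 0}"
  have fin: "finite ?A" using finite_hahn_pairs by blast
  have "hahn_coeff ((x + y) * z) q = (\<Sum>a\<in>?A. hahn_coeff (x + y) a * hahn_coeff z (q - a))"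
    by (rule hahn_coeff_mult[OF fin]) (auto simp: plus_hahn.rep_eq)
  also have "\<dots> = (\<Sum>a\<in>?A. hahn_coeff x a * hahn_coeff z (q - a)) +
                  (\<Sum>a\<in>?A. hahn_coeff y a * hahn_coeff z (q - a))"
    by (simp add: plus_hahn.rep_eq distrib_right sum.distrib)
  also have "(\<Sum>a\<in>?A. hahn_coeff x a * hahn_coeff z (q - a)) = hahn_coeff (x * z) q"
    by (rule hahn_coeff_mult[OF fin, symmetric]) auto
  also have "(\<Sum>a\<in>?A. hahn_coeff y a * hahn_coeff z (q - a)) = hahn_coeff (y * z) q"
    by (rule hahn_coeff_mult[OF fin, symmetric]) auto
  finally show "hahn_coeff ((x + y) * z) q = hahn_coeff (x * z + y * z) q"
    by (simp add: plus_hahn.rep_eq)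
qed

lemma hahn_mult_assoc: "(x * y) * z = x * (y * z :: 'a::comm_ring_1 hahn)"
proof (rule hahn_eqI)
  fix q
  let ?f = "hahn_coeff x" and ?g = "hahn_coeff y" and ?h = "hahn_coeff z"
  let ?AB = "{a + b | a b. a \<in> {q. ?f q \<noteq> 0} \<and> b \<in> {q. ?g q \<noteq> 0}}"
  let ?BC = "{a + b | a b. a \<in> {q. ?g q \<noteq> 0} \<and> b \<in> {q. ?h q \<noteq> 0}}"
  define D where "D = {d \<in> ?AB. q - d \<in> {q. ?h q \<noteq> 0}}"
  define E where "E = {a \<in> {q. ?f q \<noteq> 0}. q - a \<in> ?BC}"
  define P where "P d = {a. ?f a \<noteq> 0 \<and> ?g (d - a) \<noteq> 0}" for d
  define R where "R a = {b. ?g b \<noteq> 0 \<and> ?h (q - a - b) \<noteq> 0}" for a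
  have finD: "finite D" unfolding D_def
    by (intro well_ordered_finite_pairs well_ordered_sumset well_ordered_supp)
  have finE: "finite E" unfolding E_def
    by (intro well_ordered_finite_pairs well_ordered_sumset well_ordered_supp)
  have finP: "finite (P d)" for d unfolding P_def by (rule finite_hahn_pairs)
  have finR: "finite (R a)" for a unfolding R_def by (rule finite_hahn_pairs)
  have AB: "d \<in> ?AB" if "hahn_coeff (x * y) d \<noteq> 0" for d
  proof -
    have nz: "hahn_coeff (x * y) d \<noteq> 0" by (rule that)
    obtain a where "?f a \<noteq> 0" "?g (d - a) \<noteq> 0"
      using nz unfolding times_hahn.rep_eq by (elim sum.not_neutral_contains_not_neutral) auto
    then show ?thesis by (intro CollectI exI[of _ a] exI[of _ "d - a"]) simp
  qed
  have BC: "d \<in> ?BC" if "hahn_coeff (y * z) d \<noteq> 0" for d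
  proof -
    have nz: "hahn_coeff (y * z) d \<noteq> 0" by (rule that)
    obtain a where "?g a \<noteq> 0" "?h (d - a) \<noteq> 0"
      using nz unfolding times_hahn.rep_eq by (elim sum.not_neutral_contains_not_neutral) auto
    then show ?thesis by (intro CollectI exI[of _ a] exI[of _ "d - a"]) simp
  qed
  have "hahn_coeff ((x * y) * z) q = (\<Sum>d\<in>D. hahn_coeff (x * y) d * ?h (q - d))"
    by (rule hahn_coeff_mult[OF finD]) (use AB in \<open>auto simp: D_def\<close>)
  also have "\<dots> = (\<Sum>d\<in>D. \<Sum>a\<in>P d. ?f a * ?g (d - a) * ?h (q - d))"
    by (simp add: times_hahn.rep_eq P_def sum_distrib_right)
  also have "\<dots> = (\<Sum>(d, a)\<in>Sigma D P. ?f a * ?g (d - a) * ?h (q - d))"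
    by (rule sum.Sigma) (use finD finP in auto)
  also have "\<dots> = (\<Sum>(a, b)\<in>Sigma E R. ?f a * (?g b * ?h (q - a - b)))"
  proof (rule sum.reindex_bij_witness[of _ "\<lambda>(a, b). (a + b, a)" "\<lambda>(d, a). (a, d - a)"], goal_cases)
    case (2 u)
    then obtain d a where u: "u = (d, a)" "d \<in> D" "a \<in> P d" by auto
    have "q - a = (d - a) + (q - d)" by simp
    then have "q - a \<in> ?BC" using u unfolding D_def P_def by blast
    then show ?case using u by (auto simp: D_def P_def E_def R_def)
  next
    case (4 u)
    then obtain a b where u: "u = (a, b)" "a \<in> E" "b \<in> R a" by auto
    have "a + b \<in> ?AB" using u unfolding E_def R_def by blast
    then show ?case using u by (auto simp: D_def P_def E_def R_def diff_diff_eq)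
  qed (auto simp: mult.assoc)
  also have "\<dots> = (\<Sum>a\<in>E. \<Sum>b\<in>R a. ?f a * (?g b * ?h (q - a - b)))"
    by (rule sum.Sigma[symmetric]) (use finE finR in auto)
  also have "\<dots> = (\<Sum>a\<in>E. ?f a * hahn_coeff (y * z) (q - a))"
    by (simp add: times_hahn.rep_eq R_def sum_distrib_left)
  also have "\<dots> = hahn_coeff (x * (y * z)) q"
    by (rule hahn_coeff_mult[OF finE, symmetric]) (use BC in \<open>auto simp: E_def\<close>)
  finally show "hahn_coeff ((x * y) * z) q = hahn_coeff (x * (y * z)) q" .
qed

lemma hahn_monom_mult_coeff:
  "hahn_coeff (hahn_monom c g * x) q = c * hahn_coeff (x :: 'a::comm_ring_1 hahn) (q - g)"
  by (subst hahn_coeff_mult[of "{g}"]) (auto simp: hahn_monom.rep_eq split: if_splits)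

lemma hahn_one_mult: "1 * x = (x :: 'a::comm_ring_1 hahn)"
  by (rule hahn_eqI) (simp add: one_hahn_def hahn_monom_mult_coeff)

instance hahn :: (comm_ring_1) comm_ring_1
proof
  fix x y z :: "'a hahn"
  show "x * y * z = x * (y * z)" by (rule hahn_mult_assoc)
  show "x * y = y * x" by (rule hahn_mult_commute)
  show "1 * x = x" by (rule hahn_one_mult)
  show "(x + y) * z = x * z + y * z" by (rule hahn_distrib)
  have "hahn_coeff (0 :: 'a hahn) 0 \<noteq> hahn_coeff 1 0"
    by (simp add: zero_hahn.rep_eq one_hahn_def hahn_monom.rep_eq)
  then show "(0 :: 'a hahn) \<noteq> 1" by metis
qed

lemma hahn_monom_mult_monom:
  "hahn_monom c g * hahn_monom d h = (hahn_monom (c * d) (g + h) :: 'a::comm_ring_1 hahn)"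
  by (rule hahn_eqI) (auto simp: hahn_monom_mult_coeff hahn_monom.rep_eq)

definition supp_ge :: "rat \<Rightarrow> 'a::zero hahn \<Rightarrow> bool" where
  "supp_ge d x \<longleftrightarrow> (\<forall>q<d. hahn_coeff x q = 0)"

lemma supp_ge_mult:
  fixes x y :: "'a::comm_ring_1 hahn"
  assumes "supp_ge d x" "supp_ge e y"
  shows "supp_ge (d + e) (x * y)"
  unfolding supp_ge_def
proof (intro allI impI)
  fix q assume q: "q < d + e"
  have "{a. hahn_coeff x a \<noteq> 0 \<and> hahn_coeff y (q - a) \<noteq> 0} = {}"
  proof -
    have "q < d + e \<Longrightarrow> a < d \<or> q - a < e" for a by linarith
    then show ?thesis using assms q unfolding supp_ge_def by blast
  qed
  then show "hahn_coeff (x * y) q = 0" unfolding times_hahn.rep_eq by (metis (no_types) sum.empty)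
qed

lemma supp_ge_power:
  fixes x :: "'a::comm_ring_1 hahn"
  assumes "supp_ge d x"
  shows "supp_ge (of_nat n * d) (x ^ n)"
proof (induction n)
  case 0
  show ?case by (simp add: supp_ge_def one_hahn_def hahn_monom.rep_eq)
next
  case (Suc n)
  then show ?case using supp_ge_mult[OF assms Suc] by (simp add: algebra_simps)
qed

lemma supp_ge_add: "supp_ge d x \<Longrightarrow> supp_ge d y \<Longrightarrow> supp_ge d (x + y)"
  for x :: "'a::ab_group_add hahn"
  by (simp add: supp_ge_def plus_hahn.rep_eq)

lemma supp_ge_diff: "supp_ge d x \<Longrightarrow> supp_ge d y \<Longrightarrow> supp_ge d (x - y)"
  for x :: "'a::ab_group_add hahn"
  by (simp add: supp_ge_def minus_hahn.rep_eq)

lemma supp_ge_mono: "supp_ge d x \<Longrightarrow> e \<le> d \<Longrightarrow> supp_ge e x"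
  by (simp add: supp_ge_def)

lemma hahn_coeff_sum:
  "hahn_coeff (\<Sum>i\<in>I. x i) q = (\<Sum>i\<in>I. hahn_coeff (x i :: 'a::comm_ring_1 hahn) q)"
  by (induction I rule: infinite_finite_induct) (auto simp: zero_hahn.rep_eq plus_hahn.rep_eq)

text \<open>Since the exponent group is Archimedean, the geometric series of an element with
  support bounded below by some \<open>e > 0\<close> is locally finite.\<close>

lemma hahn_geometric:
  fixes y :: "'a::comm_ring_1 hahn"
  assumes e: "e > 0" and y: "supp_ge e y"
  shows "\<exists>z. (1 - y) * z = 1"
proof -
  define N where "N q = nat (\<lceil>q / e\<rceil> + 1)" for q
  define S where "S n = (\<Sum>i<n. y ^ i)" for n
  have N: "q < of_nat n * e" if "n \<ge> N q" for q n
  proof -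
    have "q / e < of_int (\<lceil>q / e\<rceil> + 1)" by linarith
    also have "\<dots> \<le> of_int (int (N q))" unfolding of_int_le_iff N_def by simp
    also have "\<dots> \<le> of_nat n" using that by simp
    finally show ?thesis using e by (simp add: divide_less_eq)
  qed
  have S_stable: "hahn_coeff (S n) q = hahn_coeff (S m) q" if "q < of_nat m * e" "m \<le> n" for m n q
  proof -
    have "hahn_coeff (y ^ i) q = 0" if "i \<ge> m" for i
    proof -
      have "q < of_nat i * e"
        using \<open>q < of_nat m * e\<close> that e by (meson less_le_trans less_imp_le mult_right_mono of_nat_mono)
      then show ?thesis using supp_ge_power[OF y, of i] by (simp add: supp_ge_def)
    qed
    then show ?thesis unfolding S_def hahn_coeff_sum
      using that(2) by (intro sum.mono_neutral_right) auto
  qed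
  define f where "f q = hahn_coeff (S (N q)) q" for q
  have f: "f q = hahn_coeff (S n) q" if "q < of_nat n * e" for q n
    unfolding f_def using S_stable[of q n "N q"] S_stable[of q "N q" n] N[of q "N q"] that
    by (metis nat_le_linear order_refl)
  have "well_ordered {q. f q \<noteq> 0}"
    unfolding well_ordered_iff
  proof (intro allI impI)
    fix T assume T: "T \<subseteq> {q. f q \<noteq> 0}" "T \<noteq> {}"
    then obtain t where t: "t \<in> T" by blast
    let ?T = "{q \<in> T. q \<le> t}"
    have "?T \<subseteq> {q. hahn_coeff (S (N t)) q \<noteq> 0}"
    proof
      fix q assume q: "q \<in> ?T"
      have "q < of_nat (N t) * e" using q N[of t "N t"] by auto
      then show "q \<in> {q. hahn_coeff (S (N t)) q \<noteq> 0}" using q T f[of q "N t"] by auto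
    qed
    then obtain m where "m \<in> ?T" "\<And>x. x \<in> ?T \<Longrightarrow> m \<le> x"
      using t by (elim well_orderedE[OF well_ordered_supp]) auto
    then show "\<exists>m\<in>T. \<forall>x\<in>T. m \<le> x"
      by (intro bexI[of _ m]) (auto, meson linorder_linear order_trans)
  qed
  then have co: "hahn_coeff (Abs_hahn f) q = f q" for q by (simp add: Abs_hahn_inverse)
  define z where "z = Abs_hahn f"
  have "supp_ge (of_nat n * e) ((1 - y) * z - 1)" for n
  proof -
    have a: "supp_ge (of_nat n * e) (z - S n)"
      by (simp add: supp_ge_def minus_hahn.rep_eq z_def co f)
    have b: "supp_ge 0 (1 - y)"
      by (rule supp_ge_diff) (use y e in \<open>auto simp: supp_ge_def one_hahn_def hahn_monom.rep_eq\<close>)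
    have g: "(1 - y) * S n = 1 - y ^ n"
      unfolding S_def by (rule one_diff_power_eq[symmetric])
    have "(1 - y) * z - 1 = (1 - y) * (z - S n) - y ^ n"
      using g by (simp add: algebra_simps)
    then show ?thesis
      using supp_ge_diff[OF supp_ge_mult[OF b a, simplified] supp_ge_power[OF y, of n]] by simp
  qed
  then have "hahn_coeff ((1 - y) * z - 1) q = 0" for q
    using N[of q "N q"] unfolding supp_ge_def by blast
  then have "(1 - y) * z - 1 = 0" by (intro hahn_eqI) (simp add: zero_hahn.rep_eq)
  then show ?thesis by (auto intro!: exI[of _ z])
qed

lemma hahn_leading:
  assumes "x \<noteq> 0"
  obtains g where "hahn_coeff x g \<noteq> 0" "supp_ge g x"
    "(LEAST q. hahn_coeff x q \<noteq> 0) = g"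
proof -
  have "{q. hahn_coeff x q \<noteq> 0} \<noteq> {}"
    using assms by (metis (mono_tags, lifting) Collect_empty_eq hahn_eqI zero_hahn.rep_eq)
  then have "\<exists>g\<in>{q. hahn_coeff x q \<noteq> 0}. \<forall>q\<in>{q. hahn_coeff x q \<noteq> 0}. g \<le> q"
    by (intro well_ordered_supp[of x, unfolded well_ordered_iff, rule_format] order.refl)
  then obtain g where g: "g \<in> {q. hahn_coeff x q \<noteq> 0}" "\<And>q. q \<in> {q. hahn_coeff x q \<noteq> 0} \<Longrightarrow> g \<le> q"
    by blast
  have "(LEAST q. hahn_coeff x q \<noteq> 0) = g"
    by (rule Least_equality) (use g in auto)
  moreover have "supp_ge g x" using g(2) unfolding supp_ge_def by force
  ultimately show ?thesis using g(1) that by blast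
qed

lemma hahn_unit:
  fixes x :: "'a::field hahn"
  assumes "x \<noteq> 0"
  shows "\<exists>y. x * y = 1"
proof -
  obtain g where g: "hahn_coeff x g \<noteq> 0" "supp_ge g x"
    using assms by (rule hahn_leading)
  define c where "c = hahn_coeff x g"
  define u where "u = hahn_monom (1 / c) (- g)"
  define y where "y = 1 - u * x"
  have coy: "hahn_coeff y q = (if q = 0 then 1 else 0) - hahn_coeff x (q + g) / c" for q
    by (simp add: y_def u_def minus_hahn.rep_eq one_hahn_def hahn_monom.rep_eq hahn_monom_mult_coeff)
  have y0: "hahn_coeff y q = 0" if "q \<le> 0" for q
    using that g by (cases "q = 0") (auto simp: coy c_def supp_ge_def)
  have "\<exists>e>0. supp_ge e y"
  proof (cases "y = 0")
    case True
    then show ?thesis by (intro exI[of _ 1]) (simp add: supp_ge_def zero_hahn.rep_eq)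
  next
    case False
    then obtain e where "hahn_coeff y e \<noteq> 0" "supp_ge e y" by (rule hahn_leading)
    then show ?thesis using y0 by (meson not_le)
  qed
  then obtain z where "(1 - y) * z = 1" using hahn_geometric by blast
  then have "x * (u * z) = 1" by (simp add: y_def algebra_simps)
  then show ?thesis by blast
qed

instantiation hahn :: (field) field
begin
definition inverse_hahn :: "'a hahn \<Rightarrow> 'a hahn" where
  "inverse_hahn x = (if x = 0 then 0 else (THE y. x * y = 1))"
definition divide_hahn :: "'a hahn \<Rightarrow> 'a hahn \<Rightarrow> 'a hahn" where
  "divide_hahn x y = x * inverse y"
instance
proof
  fix x y :: "'a hahn"
  show "inverse x * x = 1" if "x \<noteq> 0"
  proof -
    obtain z where z: "x * z = 1" using hahn_unit \<open>x \<noteq> 0\<close> by blast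
    have "w = z" if "x * w = 1" for w
      using z that by (metis mult.assoc mult.commute mult.right_neutral)
    then have "(THE y. x * y = 1) = z" using z by blast
    then show ?thesis using z that by (simp add: inverse_hahn_def mult.commute)
  qed
  show "x div y = x * inverse y" by (rule divide_hahn_def)
  show "inverse (0 :: 'a hahn) = 0" by (simp add: inverse_hahn_def)
qed
end

abbreviation hahn_const :: "'a::zero \<Rightarrow> 'a hahn" where
  "hahn_const c \<equiv> hahn_monom c 0"

abbreviation hahn_t :: "'a::zero_neq_one hahn" where
  "hahn_t \<equiv> hahn_monom 1 1"

text \<open>The valuation takes values in the rationals with \<open>\<infinity>\<close> (attained only at 0) added; the value
  \<open>-\<infinity>\<close> of the type \<open>extended\<close> is never attained.\<close>

definition hahn_val :: "'a::zero hahn \<Rightarrow> rat extended" where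
  "hahn_val x = (if x = 0 then \<infinity> else Fin (LEAST q. hahn_coeff x q \<noteq> 0))"

lemma hahn_val_eq_Fin:
  "hahn_val x = Fin g \<longleftrightarrow> hahn_coeff x g \<noteq> 0 \<and> supp_ge g x"
proof (cases "x = 0")
  case True
  then show ?thesis by (simp add: hahn_val_def zero_hahn.rep_eq)
next
  case False
  then obtain h where h: "hahn_coeff x h \<noteq> 0" "supp_ge h x" "(LEAST q. hahn_coeff x q \<noteq> 0) = h"
    by (rule hahn_leading)
  then show ?thesis using False
    by (auto simp: hahn_val_def supp_ge_def) (metis linorder_neqE)
qed

lemma hahn_val_eq_infinity [simp]: "hahn_val x = \<infinity> \<longleftrightarrow> x = 0"
  by (simp add: hahn_val_def)

lemma Fin_le_hahn_val: "Fin g \<le> hahn_val x \<longleftrightarrow> supp_ge g x"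
proof (cases "x = 0")
  case True
  then show ?thesis by (simp add: hahn_val_def supp_ge_def zero_hahn.rep_eq)
next
  case False
  then obtain h where h: "hahn_coeff x h \<noteq> 0" "supp_ge h x" "(LEAST q. hahn_coeff x q \<noteq> 0) = h"
    by (rule hahn_leading)
  then show ?thesis using False
    by (auto simp: hahn_val_def supp_ge_def) (meson not_le)
qed

lemma hahn_val_mult:
  fixes x y :: "'a::field hahn"
  shows "hahn_val (x * y) = hahn_val x + hahn_val y"
proof (cases "x = 0 \<or> y = 0")
  case True
  have "hahn_val z \<noteq> -\<infinity>" for z :: "'a hahn" by (simp add: hahn_val_def)
  then have "hahn_val x + hahn_val y = \<infinity>"
    using True by (metis extended.exhaust hahn_val_eq_infinity plus_extended.simps(2-4))
  then show ?thesis using True by auto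
next
  case False
  then obtain g h where g: "hahn_coeff x g \<noteq> 0" "supp_ge g x" and h: "hahn_coeff y h \<noteq> 0" "supp_ge h y"
    by (metis hahn_leading)
  have "hahn_coeff x a = 0 \<or> hahn_coeff y (g + h - a) = 0" if "a \<noteq> g" for a
  proof -
    have "a < g \<or> g + h - a < h" using that by linarith
    then show ?thesis using g(2) h(2) unfolding supp_ge_def by blast
  qed
  then have "hahn_coeff (x * y) (g + h) = hahn_coeff x g * hahn_coeff y h"
    by (subst hahn_coeff_mult[of "{g}"]) auto
  then have "hahn_val (x * y) = Fin (g + h)"
    using g h supp_ge_mult[OF g(2) h(2)] by (simp add: hahn_val_eq_Fin)
  moreover have "hahn_val x = Fin g" "hahn_val y = Fin h" using g h by (simp_all add: hahn_val_eq_Fin)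
  ultimately show ?thesis by simp
qed

lemma hahn_val_add:
  fixes x y :: "'a::field hahn"
  shows "min (hahn_val x) (hahn_val y) \<le> hahn_val (x + y)"
proof (cases "min (hahn_val x) (hahn_val y)")
  case (Fin g)
  then have "Fin g \<le> hahn_val x" "Fin g \<le> hahn_val y" by (metis min.cobounded1 min.cobounded2)+
  then show ?thesis using Fin supp_ge_add by (metis Fin_le_hahn_val)
next
  case Pinf
  then have "x = 0" "y = 0" by (metis Pinf_le hahn_val_eq_infinity min.cobounded1 min.cobounded2)+
  then show ?thesis by simp
qed simp

definition no_finite_limits :: "'a::zero hahn set \<Rightarrow> bool" where
  "no_finite_limits K \<longleftrightarrow>
     (\<forall>a\<in>K. \<forall>d::real. finite {g. real_of_rat g < d \<and> hahn_coeff a g \<noteq> 0})"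

lemma of_nat_hahn: "of_nat n = hahn_const (of_nat n :: 'a::comm_ring_1)"
proof (induction n)
  case 0
  show ?case by (rule hahn_eqI) (simp add: zero_hahn.rep_eq hahn_monom.rep_eq)
next
  case (Suc n)
  then show ?case
    by (intro hahn_eqI) (simp add: one_hahn_def plus_hahn.rep_eq hahn_monom.rep_eq)
qed

lemma CHAR_hahn [simp]: "CHAR('a::comm_ring_1 hahn) = CHAR('a)"
proof (rule CHAR_eqI)
  have eq0: "(of_nat n :: 'a hahn) = 0 \<longleftrightarrow> (of_nat n :: 'a) = 0" for n
  proof -
    have "hahn_const c = (0 :: 'a hahn) \<longleftrightarrow> c = 0" for c
    proof
      assume "hahn_const c = (0 :: 'a hahn)"
      then have "hahn_coeff (hahn_const c) 0 = hahn_coeff (0 :: 'a hahn) 0" by simp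
      then show "c = 0" by (simp add: hahn_monom.rep_eq zero_hahn.rep_eq)
    next
      assume "c = 0"
      then show "hahn_const c = (0 :: 'a hahn)"
        by (intro hahn_eqI) (simp add: hahn_monom.rep_eq zero_hahn.rep_eq)
    qed
    then show ?thesis by (simp only: of_nat_hahn)
  qed
  show "of_nat CHAR('a) = (0 :: 'a hahn)" by (simp add: eq0)
  show "CHAR('a) dvd n" if "of_nat n = (0 :: 'a hahn)" for n
    using that by (simp add: eq0 of_nat_eq_0_iff_char_dvd)
qed

section \<open>Subfields, valuations and ramification ideals\<close>

text \<open>Subfields of a field given as a type are subfields, in the sense of HOL-Algebra,
  of the corresponding record.\<close>

abbreviation adjoin :: "'a::field set \<Rightarrow> 'a \<Rightarrow> 'a set" where
  "adjoin K a \<equiv> generate_field ring_of_type_algebra (insert a K)"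

text \<open>A field of positive characteristic is perfect iff its Frobenius endomorphism is onto;
  every field of characteristic 0 is perfect.\<close>

definition perfect_subfield :: "'a::field set \<Rightarrow> bool" where
  "perfect_subfield K \<longleftrightarrow> CHAR('a) = 0 \<or> (\<forall>x\<in>K. \<exists>y\<in>K. y ^ CHAR('a) = x)"

definition val_ring :: "('a \<Rightarrow> 'g::{zero,linorder} extended) \<Rightarrow> 'a set \<Rightarrow> 'a set" where
  "val_ring v L = {x \<in> L. 0 \<le> v x}"

definition val_max_ideal :: "('a \<Rightarrow> 'g::{zero,linorder} extended) \<Rightarrow> 'a set \<Rightarrow> 'a set" where
  "val_max_ideal v L = {x \<in> L. 0 < v x}"

text \<open>Henselian in the form of Hensel's Lemma: a simple zero of the reduction lifts.\<close>

definition henselian :: "('a::field \<Rightarrow> 'g::{zero,linorder} extended) \<Rightarrow> 'a set \<Rightarrow> bool" where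
  "henselian v K \<longleftrightarrow>
     (\<forall>f a. (\<forall>i. Polynomial.coeff f i \<in> val_ring v K) \<and> a \<in> val_ring v K \<and>
        0 < v (Polynomial.poly f a) \<and> v (Polynomial.poly (Polynomial.pderiv f) a) = 0 \<longrightarrow>
        (\<exists>b\<in>val_ring v K. Polynomial.poly f b = 0 \<and> 0 < v (b - a)))"

text \<open>As in \<open>BijGroup\<close>, automorphisms of \<open>L\<close> are represented by functions that are
  \<open>undefined\<close> outside \<open>L\<close>, so that distinct elements of the group are distinct automorphisms.\<close>

definition gal_group :: "'a::field set \<Rightarrow> 'a set \<Rightarrow> ('a \<Rightarrow> 'a) monoid" where
  "gal_group L K =
     BijGroup L \<lparr>carrier := {\<sigma> \<in> Bij L.
       \<sigma> \<in> Ring.ring_hom (ring_of_type_algebra\<lparr>carrier := L\<rparr>) (ring_of_type_algebra\<lparr>carrier := L\<rparr>) \<and>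
       (\<forall>x\<in>K. \<sigma> x = x)}\<rparr>"

definition ram_I :: "('a::field \<Rightarrow> 'g::linorder extended) \<Rightarrow> 'a set \<Rightarrow> ('a \<Rightarrow> 'a) \<Rightarrow> 'a set" where
  "ram_I v L \<sigma> = {c \<in> L. \<exists>b \<in> L - {0}. v c \<ge> v ((\<sigma> b - b) / b)}"

definition ram_I_subgroup :: "('a::field \<Rightarrow> 'g::linorder extended) \<Rightarrow> 'a set \<Rightarrow> ('a \<Rightarrow> 'a) set \<Rightarrow> 'a set" where
  "ram_I_subgroup v L H = (\<Union>\<sigma>\<in>H. ram_I v L \<sigma>)"

definition Ram :: "('a::field \<Rightarrow> 'g::linorder extended) \<Rightarrow> 'a set \<Rightarrow> 'a set \<Rightarrow> 'a set set" where
  "Ram v L K = {ram_I_subgroup v L H | H.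
     subgroup H (gal_group L K) \<and> H \<noteq> {\<one>\<^bsub>gal_group L K\<^esub>}}"

definition ramification_ideals ::
    "('a::field \<Rightarrow> 'g::{zero,linorder} extended) \<Rightarrow> 'a set \<Rightarrow> 'a set \<Rightarrow> 'a set set" where
  "ramification_ideals v L K = {I \<in> Ram v L K. I \<subseteq> val_max_ideal v L}"

end

theory Submission
  imports Defs
begin

text \<open>
  The conjugates of \<open>\<theta>\<close> over \<open>K\<close> are translates \<open>\<theta> + e\<close> by constants \<open>e\<close>. The partial sums
  \<open>\<theta>\<^sub>n\<close> of the expansion \<open>\<theta> = \<Sum> (n - 1) t\<^bsup>-1/p^n\<^esup> + const\<close> lie in the
  perfect field \<open>K\<close>, but \<open>\<theta>\<close> does not, having infinitely many negative exponents. For an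
  automorphism \<open>\<sigma> \<noteq> 1\<close> and \<open>b = \<theta> - \<theta>\<^sub>n\<close> the element \<open>\<sigma> b - b\<close> is a nonzero constant while \<open>v b\<close> tends to \<open>0\<close>
  from below. Hence every \<open>I\<^sub>H\<close> contains the maximal ideal.

  It remains to find one \<open>H\<close> with \<open>I\<^sub>H\<close> inside the maximal ideal, and the group of all automorphisms
  preserving \<open>v\<close> works: there \<open>\<sigma> b = r b + \<dots>\<close> with \<open>r\<^sup>p = 1\<close>, whence \<open>r = 1\<close>. That this group is
  nontrivial is the only use of Hensel's Lemma: otherwise some \<open>c\<close> has residue \<open>1\<close> while all its
  other conjugates have residue \<open>0\<close>, so that the characteristic polynomial of \<open>c\<close> has the simple
  residual zero \<open>1\<close>, which forces \<open>c \<in> K\<close>.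
\<close>

section \<open>Subfields of a field type\<close>

lemma ring_of_type_algebra_simps [simp]:
  "carrier ring_of_type_algebra = UNIV"
  "\<zero>\<^bsub>ring_of_type_algebra\<^esub> = 0"
  "\<one>\<^bsub>ring_of_type_algebra\<^esub> = 1"
  "x \<oplus>\<^bsub>ring_of_type_algebra\<^esub> y = x + y"
  "x \<otimes>\<^bsub>ring_of_type_algebra\<^esub> y = x * y"
  by (simp_all add: ring_of_type_algebra_def)

lemma a_inv_type_algebra [simp]: "\<ominus>\<^bsub>ring_of_type_algebra\<^esub> x = - (x :: 'a::field)"
proof -
  interpret R: field "ring_of_type_algebra :: 'a ring" by (rule field_from_type_algebra)
  show ?thesis using R.minus_equality[of "- x" x] by simp
qed

lemma m_inv_type_algebra: "x \<noteq> 0 \<Longrightarrow> inv\<^bsub>ring_of_type_algebra\<^esub> x = inverse (x :: 'a::field)"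
proof -
  assume "x \<noteq> 0"
  interpret R: field "ring_of_type_algebra :: 'a ring" by (rule field_from_type_algebra)
  show ?thesis using R.inv_unique'[of x "inverse x"] \<open>x \<noteq> 0\<close> by simp
qed

locale type_subfield =
  fixes K :: "'a::field set"
  assumes subfield_K: "subfield K ring_of_type_algebra"
begin

lemma zero_mem [simp]: "0 \<in> K"
  and one_mem [simp]: "1 \<in> K"
  and add_mem: "x \<in> K \<Longrightarrow> y \<in> K \<Longrightarrow> x + y \<in> K"
  and mult_mem: "x \<in> K \<Longrightarrow> y \<in> K \<Longrightarrow> x * y \<in> K"
  and uminus_mem: "x \<in> K \<Longrightarrow> - x \<in> K"
  and inverse_mem: "x \<in> K \<Longrightarrow> inverse x \<in> K"
proof -
  interpret R: field "ring_of_type_algebra :: 'a ring" by (rule field_from_type_algebra)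
  note S = subringE[OF subfieldE(1)[OF subfield_K], simplified]
  show "0 \<in> K" "1 \<in> K" "x \<in> K \<Longrightarrow> y \<in> K \<Longrightarrow> x + y \<in> K"
    "x \<in> K \<Longrightarrow> y \<in> K \<Longrightarrow> x * y \<in> K" "x \<in> K \<Longrightarrow> - x \<in> K"
    using S by simp_all
  then show "x \<in> K \<Longrightarrow> inverse x \<in> K"
    using R.subfield_m_inv(1)[OF subfield_K, of x] by (cases "x = 0") (simp_all add: m_inv_type_algebra)
qed

lemma diff_mem: "x \<in> K \<Longrightarrow> y \<in> K \<Longrightarrow> x - y \<in> K"
  using add_mem[of x "- y"] uminus_mem[of y] by simp

lemma power_mem: "x \<in> K \<Longrightarrow> x ^ n \<in> K"
  by (induction n) (simp_all add: mult_mem)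

lemma sum_mem: "(\<And>i. i \<in> I \<Longrightarrow> f i \<in> K) \<Longrightarrow> sum f I \<in> K"
  by (induction I rule: infinite_finite_induct) (simp_all add: add_mem)

lemma of_nat_mem: "of_nat n \<in> K"
  by (induction n) (simp_all add: add_mem)

end

lemma subfield_typeI:
  fixes L :: "'a::field set"
  assumes "1 \<in> L" "\<And>x y. x \<in> L \<Longrightarrow> y \<in> L \<Longrightarrow> x + y \<in> L"
    "\<And>x y. x \<in> L \<Longrightarrow> y \<in> L \<Longrightarrow> x * y \<in> L" "\<And>x. x \<in> L \<Longrightarrow> - x \<in> L"
    "\<And>x. x \<in> L \<Longrightarrow> x \<noteq> 0 \<Longrightarrow> inverse x \<in> L"
  shows "subfield L ring_of_type_algebra"
proof -
  interpret R: field "ring_of_type_algebra :: 'a ring" by (rule field_from_type_algebra)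
  show ?thesis
    by (intro R.subfieldI' R.subringI) (use assms in \<open>auto simp: m_inv_type_algebra\<close>)
qed

lemma adjoin_subfield: "subfield (adjoin K x) (ring_of_type_algebra :: 'a::field ring)"
  by (rule field.generate_field_is_subfield) (auto intro: field_from_type_algebra)

lemma adjoin_incl: "insert x K \<subseteq> adjoin K (x :: 'a::field)"
  by (auto intro: generate_field.incl)

lemma adjoin_minimal:
  assumes "subfield L (ring_of_type_algebra :: 'a::field ring)" "insert x K \<subseteq> L"
  shows "adjoin K x \<subseteq> L"
  by (rule field.generate_field_min_subfield1) (use assms in \<open>auto intro: field_from_type_algebra\<close>)

section \<open>Polynomials over a subfield\<close>

definition polys_over :: "'a::zero set \<Rightarrow> 'a poly set" where
  "polys_over K = {f. \<forall>i. coeff f i \<in> K}"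

context type_subfield
begin

lemma polys_over_0 [simp]: "0 \<in> polys_over K"
  by (simp add: polys_over_def)

lemma polys_over_pCons [simp]: "pCons a f \<in> polys_over K \<longleftrightarrow> a \<in> K \<and> f \<in> polys_over K"
  unfolding polys_over_def by (auto simp: coeff_pCons split: nat.splits)

lemma polys_over_1 [simp]: "1 \<in> polys_over K"
  by (simp add: one_pCons)

lemma polys_over_add: "f \<in> polys_over K \<Longrightarrow> g \<in> polys_over K \<Longrightarrow> f + g \<in> polys_over K"
  by (simp add: polys_over_def add_mem)

lemma polys_over_diff: "f \<in> polys_over K \<Longrightarrow> g \<in> polys_over K \<Longrightarrow> f - g \<in> polys_over K"
  by (simp add: polys_over_def diff_mem)

lemma polys_over_uminus: "f \<in> polys_over K \<Longrightarrow> - f \<in> polys_over K"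
  by (simp add: polys_over_def uminus_mem)

lemma polys_over_mult: "f \<in> polys_over K \<Longrightarrow> g \<in> polys_over K \<Longrightarrow> f * g \<in> polys_over K"
  by (simp add: polys_over_def coeff_mult sum_mem mult_mem)

lemma polys_over_smult: "c \<in> K \<Longrightarrow> f \<in> polys_over K \<Longrightarrow> smult c f \<in> polys_over K"
  by (simp add: polys_over_def mult_mem)

lemma polys_over_monom: "c \<in> K \<Longrightarrow> Polynomial.monom c n \<in> polys_over K"
  by (simp add: polys_over_def)

lemma polys_over_power: "f \<in> polys_over K \<Longrightarrow> f ^ n \<in> polys_over K"
  by (induction n) (simp_all add: polys_over_mult)

lemma polys_over_prod: "(\<And>i. i \<in> I \<Longrightarrow> f i \<in> polys_over K) \<Longrightarrow> prod f I \<in> polys_over K"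
  by (induction I rule: infinite_finite_induct) (simp_all add: polys_over_mult)

lemma polys_over_pcompose: "f \<in> polys_over K \<Longrightarrow> g \<in> polys_over K \<Longrightarrow> f \<circ>\<^sub>p g \<in> polys_over K"
  by (induction f) (simp_all add: pcompose_pCons polys_over_add polys_over_mult)

lemma polys_over_coeff: "f \<in> polys_over K \<Longrightarrow> coeff f i \<in> K"
  by (simp add: polys_over_def)

text \<open>As \<open>m\<close> is monic, the leading term of \<open>f\<close> is cancelled by a
  monomial multiple of \<open>m\<close> with coefficient \<open>lead_coeff f\<close>, so no
  coefficient leaves \<open>K\<close>.\<close>

lemma polys_over_division:
  assumes m: "m \<in> polys_over K" "lead_coeff m = 1" and f: "f \<in> polys_over K"
  shows "\<exists>q\<in>polys_over K. \<exists>r\<in>polys_over K. f = q * m + r \<and> (r = 0 \<or> degree r < degree m)"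
  using f
proof (induction "degree f" arbitrary: f rule: less_induct)
  case less
  show ?case
  proof (cases "f = 0 \<or> degree f < degree m")
    case True
    then show ?thesis by (intro bexI[of _ 0] bexI[of _ f]) (use less.prems in auto)
  next
    case False
    define h where "h = Polynomial.monom (lead_coeff f) (degree f - degree m)"
    have h: "h \<in> polys_over K"
      unfolding h_def using less.prems by (intro polys_over_monom polys_over_coeff)
    have dh: "degree h = degree f - degree m" "lead_coeff h = lead_coeff f" "h \<noteq> 0"
      using False by (auto simp: h_def degree_monom_eq)
    have "m \<noteq> 0" using m by auto
    then have deg: "degree (h * m) = degree f" using dh False by (simp add: degree_mult_eq)
    have "coeff (h * m) (degree f) = lead_coeff f"
      using lead_coeff_mult[of h m] dh m deg by simp
    then have "f - h * m = 0 \<or> degree (f - h * m) < degree f"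
      using deg by (intro eq_zero_or_degree_less) (simp_all add: degree_diff_le)
    then obtain q r where qr: "q \<in> polys_over K" "r \<in> polys_over K" "f - h * m = q * m + r"
      "r = 0 \<or> degree r < degree m"
    proof
      assume "f - h * m = 0"
      then show ?thesis by (intro that[of 0 0]) auto
    next
      assume "degree (f - h * m) < degree f"
      then show ?thesis
        using less.hyps[of "f - h * m"] less.prems h m(1) that by (auto simp: polys_over_diff polys_over_mult)
    qed
    have "f = (q + h) * m + r" using qr(3) by (simp add: algebra_simps)
    then show ?thesis using qr(1,2,4) h by (blast intro: polys_over_add)
  qed
qed

end

section \<open>Extensions whose conjugates are translates\<close>

text \<open>The automorphisms of \<open>K(\<theta>)\<close> are the translations of \<open>\<theta>\<close> by the elements \<open>e\<close>
  for which \<open>\<theta> + e\<close> is a zero of the minimal polynomial of \<open>\<theta>\<close>. The polynomial \<open>P\<close>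
  in the assumptions forces the minimal polynomial to split into such translates.\<close>

locale translation_extension = type_subfield K for K :: "'a::field set" +
  fixes \<theta> :: 'a and E :: "'a set" and P :: "'a poly"
  assumes finite_E: "finite E" and E_sub: "E \<subseteq> K" and zero_E: "0 \<in> E"
    and add_E: "\<And>e e'. e \<in> E \<Longrightarrow> e' \<in> E \<Longrightarrow> e + e' \<in> E"
    and P_over: "P \<in> polys_over K" and P_nz: "P \<noteq> 0" and deg_P: "degree P \<le> card E"
    and P_roots: "\<And>e. e \<in> E \<Longrightarrow> poly P (\<theta> + e) = 0"
    and theta_notin: "\<theta> \<notin> K"
begin

section \<open>The group of translations compatible with all relations of \<theta> over
  \<open>K\<close>\<close>

definition L :: "'a set" where
  "L = (\<lambda>f. poly f \<theta>) ` polys_over K"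

text \<open>These are the \<open>e\<close> in \<open>E\<close> for which sending f(\<theta>) to
  f(\<theta> + e) is well defined on \<open>L\<close>; \<open>W\<close> stands in for the Galois
  group before any automorphism is built.\<close>

definition W :: "'a set" where
  "W = {e \<in> E. \<forall>f\<in>polys_over K. poly f \<theta> = 0 \<longrightarrow> poly f (\<theta> + e) = 0}"

lemma finite_W: "finite W" and W_sub: "W \<subseteq> K" and zero_W: "0 \<in> W"
  using finite_E E_sub zero_E by (auto simp: W_def)

lemma translate_over: "f \<in> polys_over K \<Longrightarrow> e \<in> K \<Longrightarrow> f \<circ>\<^sub>p [:e, 1:] \<in> polys_over K"
  by (intro polys_over_pcompose) simp_all

lemma poly_translate: "poly ((f :: 'a poly) \<circ>\<^sub>p [:e, 1:]) x = poly f (x + e)"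
  by (simp add: poly_pcompose algebra_simps)

text \<open>Since \<open>e\<close> lies in \<open>K\<close>, the shifted polynomial f(X + e) is
  again over \<open>K\<close>, and the defining property of \<open>e'\<close> applies to it.\<close>

lemma add_W: "e + e' \<in> W" if "e \<in> W" "e' \<in> W"
proof -
  have "poly f (\<theta> + (e + e')) = 0" if f: "f \<in> polys_over K" "poly f \<theta> = 0" for f
  proof -
    have "poly (f \<circ>\<^sub>p [:e, 1:]) \<theta> = 0" using f \<open>e \<in> W\<close> by (simp add: poly_translate W_def)
    then have "poly (f \<circ>\<^sub>p [:e, 1:]) (\<theta> + e') = 0"
      using f(1) translate_over[of f e] \<open>e \<in> W\<close> \<open>e' \<in> W\<close> W_sub
      by (auto simp: W_def simp del: poly_pcompose)
    then show ?thesis by (simp add: poly_translate add_ac)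
  qed
  then show ?thesis using that add_E by (simp add: W_def)
qed

text \<open>An injective self-map of a finite set is onto. This supplies negatives in
  \<open>W\<close>, although \<open>E\<close> is only assumed closed under addition.\<close>

lemma bij_betw_add_W: "e \<in> W \<Longrightarrow> bij_betw (\<lambda>x. x + e) W W"
  unfolding bij_betw_def
proof
  assume e: "e \<in> W"
  show inj: "inj_on (\<lambda>x. x + e) W" by simp
  show "(\<lambda>x. x + e) ` W = W"
    using inj e add_W by (intro endo_inj_surj[OF finite_W]) auto
qed

lemma uminus_W: "- e \<in> W" if "e \<in> W"
proof -
  have "0 \<in> (\<lambda>x. x + e) ` W"
    using bij_betw_add_W[OF that] zero_W by (simp add: bij_betw_def)
  then show ?thesis by (auto simp: eq_neg_iff_add_eq_0[symmetric])
qed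

lemma diff_W: "e \<in> W \<Longrightarrow> e' \<in> W \<Longrightarrow> e - e' \<in> W"
  using add_W[of e "- e'"] uminus_W by simp

text \<open>Division with remainder shows that \<open>m\<close> divides every polynomial over
  \<open>K\<close> vanishing at \<theta>, in particular \<open>P\<close>. Degree 1 would put
  \<theta> into \<open>K\<close>. The bound by \<open>card W\<close> says that the translates
  exhaust the zeros of \<open>m\<close>.\<close>

lemma minimal_polynomial:
  obtains m where "m \<in> polys_over K" "lead_coeff m = 1" "poly m \<theta> = 0" "1 < degree m"
    "degree m \<le> card W" "\<forall>e\<in>W. poly m (\<theta> + e) = 0"
proof -
  define S where "S = {f \<in> polys_over K. f \<noteq> 0 \<and> poly f \<theta> = 0}"
  have "P \<in> S" using P_over P_nz P_roots[OF zero_E] by (simp add: S_def)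
  then obtain m0 where m0: "m0 \<in> S" "\<And>f. f \<in> S \<Longrightarrow> degree m0 \<le> degree f"
    using exists_least_iff[of "\<lambda>n. \<exists>f\<in>S. degree f = n"] by (metis not_le)
  define m where "m = smult (inverse (lead_coeff m0)) m0"
  have m: "m \<in> polys_over K" "lead_coeff m = 1" "poly m \<theta> = 0" "degree m = degree m0"
    using m0(1) by (auto simp: m_def S_def intro!: polys_over_smult inverse_mem polys_over_coeff)
  have multiple: "\<exists>q. f = q * m" if f: "f \<in> polys_over K" "poly f \<theta> = 0" for f
  proof -
    obtain q r where qr: "q \<in> polys_over K" "r \<in> polys_over K" "f = q * m + r"
      "r = 0 \<or> degree r < degree m"
      using polys_over_division[OF m(1,2) f(1)] by blast
    have "r = 0" using qr m f m0(2)[of r] by (fastforce simp: S_def)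
    then show ?thesis using qr by auto
  qed
  have "1 < degree m"
  proof (rule ccontr)
    assume "\<not> 1 < degree m"
    then have eq: "m = [:coeff m 0, coeff m 1:]"
      by (intro poly_eqI) (auto simp: coeff_pCons coeff_eq_0 split: nat.splits)
    show False
    proof (cases "degree m = 0")
      case True
      then show False using m(2,3) by (metis degree_eq_zeroE degree_pCons_0 coeff_pCons_0 poly_const_conv zero_neq_one)
    next
      case False
      then have "degree m = 1" using \<open>\<not> 1 < degree m\<close> by simp
      then have "coeff m 0 + \<theta> = 0"
        using m(2,3) arg_cong[OF eq, of "\<lambda>f. poly f \<theta>"] by (simp add: algebra_simps)
      then have "\<theta> = - coeff m 0" by (simp add: eq_neg_iff_add_eq_0 add.commute)
      then show False using theta_notin polys_over_coeff[OF m(1), of 0] uminus_mem by auto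
    qed
  qed
  have W: "W = {e \<in> E. poly m (\<theta> + e) = 0}"
    using multiple m by (fastforce simp: W_def)
  have "poly P \<theta> = 0" using P_roots[OF zero_E] by simp
  then obtain q where q: "P = q * m" using multiple[OF P_over] by blast
  have "q \<noteq> 0" "m \<noteq> 0" using q P_nz by auto
  \<comment> \<open>A zero \<theta> + e of P = q m that is not a zero of m is a zero of q. So |E| -
    |W| \<le> deg q, and with deg P \<le> |E| this gives deg m \<le> |W|.\<close>
  have "(+) \<theta> ` (E - W) \<subseteq> {x. poly q x = 0}"
    using P_roots q by (auto simp: W)
  then have "card ((+) \<theta> ` (E - W)) \<le> card {x. poly q x = 0}"
    using poly_roots_finite[OF \<open>q \<noteq> 0\<close>] by (rule card_mono[rotated])
  also have "\<dots> \<le> degree q" by (rule card_poly_roots_bound[OF \<open>q \<noteq> 0\<close>])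
  finally have "card E - card W \<le> degree q"
    using finite_W by (simp add: card_image card_Diff_subset W)
  moreover have "degree P = degree q + degree m" using q P_nz by (simp add: degree_mult_eq)
  ultimately have "degree m \<le> card W" using deg_P by simp
  moreover have "\<forall>e\<in>W. poly m (\<theta> + e) = 0" using W by blast
  ultimately show ?thesis using that[OF m(1-3) \<open>1 < degree m\<close>] by blast
qed

lemma nonzero_W: obtains e where "e \<in> W" "e \<noteq> 0"
proof -
  obtain m :: "'a poly" where "1 < degree m" "degree m \<le> card W"
    using minimal_polynomial by blast
  then have "1 < card W" by simp
  have "\<not> W \<subseteq> {0}"
  proof
    assume "W \<subseteq> {0}"
    then have "card W \<le> card {0 :: 'a}" by (intro card_mono) auto
    then show False using \<open>1 < card W\<close> by simp
  qed
  then show ?thesis using that by auto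
qed

text \<open>The fixed field of the translations is \<open>K\<close>: the remainder of
  \<open>f\<close> modulo \<open>m\<close> takes the value f(\<theta>) at |W| points, more than its
  degree, so it is constant, and its constant coefficient lies in \<open>K\<close>.\<close>

lemma translates_eq_imp_mem:
  assumes f: "f \<in> polys_over K" and inv: "\<And>e. e \<in> W \<Longrightarrow> poly f (\<theta> + e) = poly f \<theta>"
  shows "poly f \<theta> \<in> K"
proof -
  obtain m where m: "m \<in> polys_over K" "lead_coeff m = 1" "poly m \<theta> = 0" "1 < degree m"
    "degree m \<le> card W" "\<forall>e\<in>W. poly m (\<theta> + e) = 0"
    by (rule minimal_polynomial)
  obtain q r where qr: "r \<in> polys_over K" "f = q * m + r" "r = 0 \<or> degree r < degree m"
    using polys_over_division[OF m(1,2) f(1)] by blast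
  define s where "s = r - [:poly f \<theta>:]"
  have "degree s < degree m"
    unfolding s_def using qr(3) m(4) by (intro degree_diff_less) auto
  have "poly s (\<theta> + e) = 0" if "e \<in> W" for e
    using inv[OF that] m(6) that by (simp add: s_def qr(2))
  then have roots: "(+) \<theta> ` W \<subseteq> {x. poly s x = 0}" by blast
  have "s = 0"
  proof (rule ccontr)
    assume "s \<noteq> 0"
    have "card ((+) \<theta> ` W) \<le> card {x. poly s x = 0}"
      by (rule card_mono[OF poly_roots_finite[OF \<open>s \<noteq> 0\<close>] roots])
    also have "\<dots> \<le> degree s" by (rule card_poly_roots_bound[OF \<open>s \<noteq> 0\<close>])
    finally show False using \<open>degree s < degree m\<close> m(5) by (simp add: card_image)
  qed
  then have "poly f \<theta> = coeff r 0" by (simp add: s_def)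
  then show ?thesis using polys_over_coeff[OF qr(1)] by simp
qed

lemma prod_translates_W: "(\<Prod>e\<in>W. h (\<theta> + e' + e)) = (\<Prod>e\<in>W. h (\<theta> + e))" if "e' \<in> W"
  using prod.reindex_bij_betw[OF bij_betw_add_W[OF that], of "\<lambda>e. h (\<theta> + e)"]
  by (simp add: add_ac)

section \<open>The polynomial values \<open>L\<close> form the field generated by \<theta>\<close>

lemma K_sub_L: "K \<subseteq> L"
proof
  fix x assume "x \<in> K"
  then show "x \<in> L" unfolding L_def by (intro image_eqI[of _ _ "[:x:]"]) simp_all
qed

lemma theta_mem_L: "\<theta> \<in> L"
  unfolding L_def by (intro image_eqI[of _ _ "[:0, 1:]"]) simp_all

lemma poly_mem_L: "f \<in> polys_over K \<Longrightarrow> poly f \<theta> \<in> L"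
  by (simp add: L_def)

lemma poly_translate_mem_L: "f \<in> polys_over K \<Longrightarrow> e \<in> W \<Longrightarrow> poly f (\<theta> + e) \<in> L"
  using poly_mem_L[OF translate_over[of f e]] W_sub by (auto simp: poly_translate)

lemma poly_translate_cong:
  assumes "f \<in> polys_over K" "g \<in> polys_over K" "poly f \<theta> = poly g \<theta>" "e \<in> W"
  shows "poly f (\<theta> + e) = poly g (\<theta> + e)"
proof -
  have "poly (f - g) \<theta> = 0 \<longrightarrow> poly (f - g) (\<theta> + e) = 0"
    using assms polys_over_diff[of f g] unfolding W_def by blast
  then show ?thesis using assms(3) by simp
qed

text \<open>The norm N, the product of all f(\<theta> + e), is translation invariant and so lies in
  \<open>K\<close>. It equals x times the product over e \<noteq> 0, which is a polynomial in
  \<theta>.\<close>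

lemma inverse_mem_L:
  assumes "x \<in> L" "x \<noteq> 0"
  shows "inverse x \<in> L"
proof -
  obtain f where f: "f \<in> polys_over K" "x = poly f \<theta>" using assms(1) by (auto simp: L_def)
  define g where "g A = (\<Prod>e\<in>A. f \<circ>\<^sub>p [:e, 1:])" for A
  have g: "g A \<in> polys_over K" if "A \<subseteq> W" for A
    unfolding g_def using that W_sub f by (intro polys_over_prod translate_over) auto
  have poly_g: "poly (g A) u = (\<Prod>e\<in>A. poly f (u + e))" for A u
    by (simp add: g_def poly_prod poly_translate)
  \<comment> \<open>If f(X + e) vanished at \<theta>, it would also vanish at \<theta> - e because
    -e is in \<open>W\<close>; that would give f(\<theta>) = 0.\<close>
  have nz: "poly f (\<theta> + e) \<noteq> 0" if e: "e \<in> W" for e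
  proof
    assume "poly f (\<theta> + e) = 0"
    then have "poly (f \<circ>\<^sub>p [:e, 1:]) (\<theta> + - e) = 0"
      using e f(1) W_sub uminus_W[OF e] translate_over[of f e]
      by (intro poly_translate_cong[of _ 0, simplified]) (auto simp: poly_translate)
    then show False using assms(2) f(2) by (simp add: poly_translate)
  qed
  define N where "N = poly (g W) \<theta>"
  have "N \<in> K"
    unfolding N_def by (rule translates_eq_imp_mem) (simp_all add: g poly_g prod_translates_W)
  have "N \<noteq> 0" using nz finite_W by (simp add: N_def poly_g)
  have "N = x * poly (g (W - {0})) \<theta>"
    unfolding N_def poly_g f(2) using prod.remove[OF finite_W zero_W, of "\<lambda>e. poly f (\<theta> + e)"] by simp
  then have "inverse x = poly (smult (inverse N) (g (W - {0}))) \<theta>"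
    using \<open>N \<noteq> 0\<close> by (simp add: field_simps)
  moreover have "smult (inverse N) (g (W - {0})) \<in> polys_over K"
    by (intro polys_over_smult inverse_mem g \<open>N \<in> K\<close>) auto
  ultimately show ?thesis by (simp only: poly_mem_L)
qed

lemma subfield_L: "subfield L ring_of_type_algebra"
proof (rule subfield_typeI)
  fix x y assume "x \<in> L" "y \<in> L"
  then obtain f g where fg: "f \<in> polys_over K" "g \<in> polys_over K" "x = poly f \<theta>" "y = poly g \<theta>"
    by (auto simp: L_def)
  show "x + y \<in> L" "x * y \<in> L" "- x \<in> L"
    using poly_mem_L[of "f + g"] poly_mem_L[of "f * g"] poly_mem_L[of "- f"] fg
    by (simp_all add: polys_over_add polys_over_mult polys_over_uminus)
qed (use K_sub_L inverse_mem_L in auto)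

sublocale L: type_subfield L
  by (rule type_subfield.intro) (rule subfield_L)

lemma adjoin_eq_L: "adjoin K \<theta> = L"
proof
  show "adjoin K \<theta> \<subseteq> L"
    by (rule adjoin_minimal[OF subfield_L]) (use K_sub_L theta_mem_L in auto)
  interpret A: type_subfield "adjoin K \<theta>"
    by (rule type_subfield.intro) (rule adjoin_subfield)
  have "poly f \<theta> \<in> adjoin K \<theta>" if "f \<in> polys_over K" for f
    using that adjoin_incl[of \<theta> K] unfolding polys_over_def poly_altdef
    by (intro A.sum_mem A.mult_mem A.power_mem) auto
  then show "L \<subseteq> adjoin K \<theta>" by (auto simp: L_def)
qed

section \<open>The automorphisms of \<open>L\<close> given by the translations\<close>

definition conj :: "'a \<Rightarrow> 'a \<Rightarrow> 'a" where
  "conj e x = poly (SOME f. f \<in> polys_over K \<and> poly f \<theta> = x) (\<theta> + e)"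

text \<open>The choice made in \<open>conj\<close> is harmless: by
  \<open>poly_translate_cong\<close> polynomials with equal values at \<theta> have equal values at
  \<theta> + e.\<close>

lemma conj_poly: "conj e (poly f \<theta>) = poly f (\<theta> + e)" if "f \<in> polys_over K" "e \<in> W"
proof -
  define g where "g = (SOME g. g \<in> polys_over K \<and> poly g \<theta> = poly f \<theta>)"
  have "g \<in> polys_over K \<and> poly g \<theta> = poly f \<theta>"
    unfolding g_def by (rule someI[of _ f]) (use that in simp)
  then show ?thesis
    unfolding conj_def g_def[symmetric] using that by (intro poly_translate_cong) auto
qed

lemma conj_add: "conj e (x + y) = conj e x + conj e y"
  and conj_mult: "conj e (x * y) = conj e x * conj e y" if xy: "x \<in> L" "y \<in> L" "e \<in> W"
proof -
  obtain f g where fg: "f \<in> polys_over K" "g \<in> polys_over K" "x = poly f \<theta>" "y = poly g \<theta>"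
    using xy by (auto simp: L_def)
  show "conj e (x + y) = conj e x + conj e y" "conj e (x * y) = conj e x * conj e y"
    using conj_poly[of "f + g" e] conj_poly[of "f * g" e] conj_poly[of f e] conj_poly[of g e] fg that
    by (simp_all add: polys_over_add polys_over_mult)
qed

lemma conj_base: "x \<in> K \<Longrightarrow> e \<in> W \<Longrightarrow> conj e x = x"
  using conj_poly[of "[:x:]" e] by simp

lemma conj_theta: "e \<in> W \<Longrightarrow> conj e \<theta> = \<theta> + e"
  using conj_poly[of "[:0, 1:]" e] by simp

lemma conj_mem: "x \<in> L \<Longrightarrow> e \<in> W \<Longrightarrow> conj e x \<in> L"
  by (auto simp: L_def conj_poly poly_translate_mem_L[unfolded L_def])

lemma conj_conj: "conj e (conj e' x) = conj (e + e') x" if x: "x \<in> L" "e \<in> W" "e' \<in> W"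
proof -
  obtain f where f: "f \<in> polys_over K" "x = poly f \<theta>" using x by (auto simp: L_def)
  have "conj e (poly (f \<circ>\<^sub>p [:e', 1:]) \<theta>) = poly (f \<circ>\<^sub>p [:e', 1:]) (\<theta> + e)"
    using f that W_sub by (intro conj_poly translate_over) auto
  then show ?thesis using f that by (simp add: conj_poly poly_translate add_W add_ac)
qed

lemma conj_0: "x \<in> L \<Longrightarrow> conj 0 x = x"
  using zero_W by (auto simp: L_def conj_poly)

lemma conj_power: "x \<in> L \<Longrightarrow> e \<in> W \<Longrightarrow> conj e (x ^ n) = conj e x ^ n"
  by (induction n) (simp_all add: conj_base conj_mult L.power_mem)

lemma conj_uminus: "x \<in> L \<Longrightarrow> e \<in> W \<Longrightarrow> conj (- e) (conj e x) = x"
  by (simp add: conj_conj uminus_W conj_0)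

lemma conj_eq_0_iff: "x \<in> L \<Longrightarrow> e \<in> W \<Longrightarrow> conj e x = 0 \<longleftrightarrow> x = 0"
  by (metis conj_uminus conj_base zero_mem uminus_W)

text \<open>This is the characteristic polynomial of \<open>x\<close>. Its coefficients are values
  at \<theta> of polynomials over \<open>K\<close>; moving \<theta> to \<theta> + e only permutes
  the factors, so \<open>translates_eq_imp_mem\<close> applies. To make this argument, the point
  \<theta> is replaced by a variable \<open>u\<close>.\<close>

lemma prod_conj_over: "(\<Prod>e\<in>W. [:- conj e x, 1:]) \<in> polys_over K" if x: "x \<in> L"
proof -
  obtain f where f: "f \<in> polys_over K" "x = poly f \<theta>" using x by (auto simp: L_def)
  define F where "F A u = (\<Prod>e\<in>A. [:- poly f (u + e), 1:])" for A u
  have coeffs: "\<exists>g\<in>polys_over K. \<forall>u. coeff (F A u) i = poly g u" if "finite A" "A \<subseteq> W" for A i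
    using that
  proof (induction A arbitrary: i rule: finite_induct)
    case empty
    show ?case
      by (intro bexI[of _ "if i = 0 then 1 else 0"]) (simp_all add: F_def)
  next
    case (insert e A)
    obtain g where g: "g i \<in> polys_over K" "coeff (F A u) i = poly (g i) u" for i u
      using insert by (metis insert_subset)
    have e: "e \<in> K" using insert.prems W_sub by auto
    \<comment> \<open>Coefficient recursion for multiplication by a monic linear factor; coefficient
      0 receives no shifted term.\<close>
    have "coeff (F (insert e A) u) i =
        poly (- (f \<circ>\<^sub>p [:e, 1:]) * g i + (if i = 0 then 0 else g (i - 1))) u" for u
      using insert.hyps g(2) by (cases i) (simp_all add: F_def poly_translate)
    moreover have "- (f \<circ>\<^sub>p [:e, 1:]) * g i + (if i = 0 then 0 else g (i - 1)) \<in> polys_over K"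
      using g(1) translate_over[OF f(1) e]
      by (intro polys_over_add polys_over_mult polys_over_uminus) simp_all
    ultimately show ?case by (intro bexI allI)
  qed
  have "coeff (F W \<theta>) i \<in> K" for i
  proof -
    obtain g where g: "g \<in> polys_over K" "\<And>u. coeff (F W u) i = poly g u"
      using coeffs[OF finite_W order.refl] by blast
    have "F W (\<theta> + e) = F W \<theta>" if "e \<in> W" for e
      unfolding F_def using prod_translates_W[OF that, of "\<lambda>u. [:- poly f u, 1:]"] by simp
    then show ?thesis using translates_eq_imp_mem[OF g(1)] by (simp flip: g(2))
  qed
  moreover have "(\<Prod>e\<in>W. [:- conj e x, 1:]) = F W \<theta>"
    unfolding F_def by (intro prod.cong) (simp_all add: f conj_poly)
  ultimately show ?thesis by (simp add: polys_over_def)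
qed

end

section \<open>The valuation of the Hahn series field\<close>

text \<open>A rational-valued form of \<open>hahn_val\<close> that allows subtraction; the value at
  0 is unspecified, so later statements assume a nonzero argument.\<close>

definition hahn_ord :: "'a::zero hahn \<Rightarrow> rat" where
  "hahn_ord x = (LEAST q. hahn_coeff x q \<noteq> 0)"

lemma hahn_val_ord: "x \<noteq> 0 \<Longrightarrow> hahn_val x = Fin (hahn_ord x)"
  by (simp add: hahn_val_def hahn_ord_def)

lemma hahn_ord_eqI: "hahn_val x = Fin g \<Longrightarrow> hahn_ord x = g"
  by (metis extended.distinct(1) extended.inject hahn_val_eq_infinity hahn_val_ord)

lemma coeff_hahn_ord: "x \<noteq> 0 \<Longrightarrow> hahn_coeff x (hahn_ord x) \<noteq> 0"
  using hahn_val_eq_Fin hahn_val_ord by blast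

lemma hahn_ord_mult:
  fixes x y :: "'a::field hahn"
  shows "x \<noteq> 0 \<Longrightarrow> y \<noteq> 0 \<Longrightarrow> hahn_ord (x * y) = hahn_ord x + hahn_ord y"
  by (rule hahn_ord_eqI) (simp add: hahn_val_mult hahn_val_ord)

lemma hahn_val_monom: "c \<noteq> 0 \<Longrightarrow> hahn_val (hahn_monom c g) = Fin g"
  by (simp add: hahn_val_eq_Fin hahn_monom.rep_eq supp_ge_def)

lemma hahn_ord_monom: "c \<noteq> 0 \<Longrightarrow> hahn_ord (hahn_monom c g) = g"
  by (rule hahn_ord_eqI) (rule hahn_val_monom)

lemma hahn_monom_eq_0_iff: "hahn_monom c g = 0 \<longleftrightarrow> c = 0"
  by (metis hahn_val_monom hahn_eqI hahn_monom.rep_eq zero_hahn.rep_eq extended.distinct(1) hahn_val_eq_infinity)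

lemma hahn_ord_power:
  fixes x :: "'a::field hahn"
  shows "x \<noteq> 0 \<Longrightarrow> hahn_ord (x ^ n) = of_nat n * hahn_ord x"
  by (induction n) (simp_all add: hahn_ord_mult hahn_ord_monom one_hahn_def[symmetric] algebra_simps
    hahn_ord_monom[of "1 :: 'a" 0, folded one_hahn_def])

lemma Fin_less_hahn_val: "Fin g < hahn_val x \<longleftrightarrow> (\<forall>q\<le>g. hahn_coeff x q = 0)"
proof -
  have "Fin g < hahn_val x \<longleftrightarrow> Fin g \<le> hahn_val x \<and> hahn_val x \<noteq> Fin g" by auto
  then show ?thesis
    unfolding Fin_le_hahn_val hahn_val_eq_Fin supp_ge_def by (metis order.order_iff_strict)
qed

section \<open>The valuation ring and its residue map, the coefficient at exponent 0\<close>

lemma hahn_val_eq_0_iff: "hahn_val x = 0 \<longleftrightarrow> supp_ge 0 x \<and> hahn_coeff x 0 \<noteq> 0"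
  by (simp add: zero_extended_def hahn_val_eq_Fin conj_commute)

lemma hahn_val_ge_0_iff: "0 \<le> hahn_val x \<longleftrightarrow> supp_ge 0 x"
  by (simp add: zero_extended_def Fin_le_hahn_val)

lemma hahn_val_gt_0_iff: "0 < hahn_val x \<longleftrightarrow> supp_ge 0 x \<and> hahn_coeff x 0 = 0"
  unfolding zero_extended_def Fin_less_hahn_val supp_ge_def by (metis order.order_iff_strict)

text \<open>Among nonnegative exponents only 0 + 0 adds up to 0, so taking residues is
  multiplicative.\<close>

lemma coeff_0_mult:
  fixes x y :: "'a::comm_ring_1 hahn"
  assumes "supp_ge 0 x" "supp_ge 0 y"
  shows "hahn_coeff (x * y) 0 = hahn_coeff x 0 * hahn_coeff y 0"
proof -
  have "hahn_coeff x a = 0 \<or> hahn_coeff y (0 - a) = 0" if "a \<noteq> 0" for a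
    using assms that unfolding supp_ge_def by (metis diff_0 neg_less_0_iff_less neqE)
  then show ?thesis by (subst hahn_coeff_mult[of "{0}"]) auto
qed

lemma supp_ge_0_mult: "supp_ge 0 x \<Longrightarrow> supp_ge 0 y \<Longrightarrow> supp_ge 0 (x * y)"
  for x y :: "'a::comm_ring_1 hahn"
  using supp_ge_mult[of 0 x 0 y] by simp

lemma supp_ge_0_1 [simp]: "supp_ge 0 (1 :: 'a::comm_ring_1 hahn)"
  by (simp add: supp_ge_def one_hahn_def hahn_monom.rep_eq)

lemma supp_ge_zero [simp]: "supp_ge g 0"
  by (simp add: supp_ge_def zero_hahn.rep_eq)

lemma supp_ge_sum: "(\<And>i. i \<in> I \<Longrightarrow> supp_ge g (f i)) \<Longrightarrow> supp_ge g (sum f I)"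
  for f :: "'b \<Rightarrow> 'a::comm_ring_1 hahn"
  by (simp add: supp_ge_def hahn_coeff_sum)

lemma coeff_0_1: "hahn_coeff 1 0 = 1"
  by (simp add: one_hahn_def hahn_monom.rep_eq)

lemma
  fixes f :: "'b \<Rightarrow> 'a::comm_ring_1 hahn"
  assumes "\<And>i. i \<in> I \<Longrightarrow> supp_ge 0 (f i)"
  shows supp_ge_0_prod: "supp_ge 0 (prod f I)"
    and coeff_0_prod: "hahn_coeff (prod f I) 0 = (\<Prod>i\<in>I. hahn_coeff (f i) 0)"
proof -
  have "supp_ge 0 (prod f I) \<and> hahn_coeff (prod f I) 0 = (\<Prod>i\<in>I. hahn_coeff (f i) 0)"
    using assms by (induction I rule: infinite_finite_induct)
      (simp_all add: coeff_0_1 supp_ge_0_mult coeff_0_mult)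
  then show "supp_ge 0 (prod f I)" "hahn_coeff (prod f I) 0 = (\<Prod>i\<in>I. hahn_coeff (f i) 0)"
    by simp_all
qed

lemma supp_ge_0_coeff_linear_prod:
  fixes f :: "'b \<Rightarrow> 'a::field hahn"
  assumes "\<And>e. e \<in> A \<Longrightarrow> supp_ge 0 (f e)"
  shows "supp_ge 0 (coeff (\<Prod>e\<in>A. [:- f e, 1:]) i)"
  using assms
proof (induction A arbitrary: i rule: infinite_finite_induct)
  case (insert e A)
  have "supp_ge 0 (- f e * x)" if "supp_ge 0 x" for x
    using insert.prems[of e] that supp_ge_diff[of 0 0 "f e * x"] supp_ge_0_mult[of "f e" x] by simp
  then show ?case using insert by (cases i) (simp_all add: supp_ge_add supp_ge_diff supp_ge_0_mult)
qed (simp_all add: coeff_1 split: if_splits)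

section \<open>A nontrivial automorphism preserving the valuation\<close>

locale hahn_translation_extension = translation_extension K \<theta> E P
  for K :: "'k::field hahn set" and \<theta> E P +
  assumes const_mem: "hahn_const c \<in> K" and t_mem: "hahn_t \<in> K"
    and hensel: "henselian hahn_val K"
begin

text \<open>Needed to shift an integral value to 0 by a factor from \<open>K\<close>, which every
  conjugation fixes.\<close>

lemma t_power_mem: "hahn_monom 1 (of_int k) \<in> K"
proof -
  have nat: "hahn_monom 1 (of_nat n) \<in> K" for n
  proof (induction n)
    case 0
    show ?case using one_mem by (simp add: one_hahn_def)
  next
    case (Suc n)
    then show ?case using mult_mem[OF t_mem Suc] by (simp add: hahn_monom_mult_monom)
  qed
  show ?thesis
  proof (cases k)
    case (nonneg n)
    then show ?thesis using nat by simp
  next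
    case (neg n)
    have "hahn_monom 1 (of_int k) * hahn_monom 1 (of_nat (Suc n)) = (1 :: 'k hahn)"
      by (simp add: neg hahn_monom_mult_monom one_hahn_def)
    then have "hahn_monom 1 (of_int k) = inverse (hahn_monom 1 (of_nat (Suc n)) :: 'k hahn)"
      by (metis inverse_unique mult.commute)
    then show ?thesis using inverse_mem[OF nat] by metis
  qed
qed

text \<open>If no nontrivial automorphism preserves the valuation, then the functions
  \<open>x \<mapsto> v(\<sigma> x)\<close> are pairwise distinct homomorphisms into the rationals, so some \<open>x\<close>
  separates all of them.\<close>

lemma separating_element:
  assumes no_inv: "\<And>e. e \<in> W \<Longrightarrow> e \<noteq> 0 \<Longrightarrow> \<exists>x\<in>L. hahn_val (conj e x) \<noteq> hahn_val x"
  shows "\<exists>x\<in>L. x \<noteq> 0 \<and> inj_on (\<lambda>e. hahn_ord (conj e x)) W"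
proof -
  define \<Delta> where "\<Delta> s x = hahn_ord (conj (fst s) x) - hahn_ord (conj (snd s) x)" for s x
  have \<Delta>_mult: "\<Delta> s (x ^ n * y) = of_nat n * \<Delta> s x + \<Delta> s y"
    if "s \<in> W \<times> W" "x \<in> L" "x \<noteq> 0" "y \<in> L" "y \<noteq> 0" for s x y n
    using that by (auto simp: \<Delta>_def conj_mult conj_power hahn_ord_mult hahn_ord_power conj_eq_0_iff
        L.power_mem algebra_simps)
  have pair: "\<exists>y\<in>L. y \<noteq> 0 \<and> \<Delta> s y \<noteq> 0" if s: "s \<in> W \<times> W" "fst s \<noteq> snd s" for s
  proof -
    obtain e e' where e: "s = (e, e')" "e \<in> W" "e' \<in> W" "e \<noteq> e'" using s by (cases s) auto
    obtain z where z: "z \<in> L" "hahn_val (conj (e - e') z) \<noteq> hahn_val z"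
      using no_inv[of "e - e'"] e diff_W by auto
    have z0: "z \<noteq> 0" using z conj_base[of 0 "e - e'"] e diff_W by auto
    \<comment> \<open>Translating by -e' turns the pair (e, e') into (e - e', 0), for which
      \<open>z\<close> is a witness.\<close>
    define y where "y = conj (- e') z"
    have y: "y \<in> L" "y \<noteq> 0" "conj e' y = z" "conj e y = conj (e - e') z"
      using z z0 e uminus_W[of e']
      by (auto simp: y_def conj_mem conj_eq_0_iff conj_conj conj_0)
    have "hahn_ord (conj (e - e') z) \<noteq> hahn_ord z"
      using z z0 e by (auto simp: hahn_val_ord conj_eq_0_iff diff_W)
    then show ?thesis using y by (intro bexI[of _ y]) (simp_all add: \<Delta>_def e(1))
  qed
  have "\<exists>x\<in>L. x \<noteq> 0 \<and> (\<forall>s\<in>S. \<Delta> s x \<noteq> 0)"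
    if "finite S" "S \<subseteq> {s \<in> W \<times> W. fst s \<noteq> snd s}" for S
    using that
  proof (induction S rule: finite_induct)
    case empty
    show ?case by (intro bexI[of _ 1]) auto
  next
    case (insert s S)
    then obtain x where x: "x \<in> L" "x \<noteq> 0" "\<And>s. s \<in> S \<Longrightarrow> \<Delta> s x \<noteq> 0" by auto
    show ?case
    proof (cases "\<Delta> s x = 0")
      case False
      then show ?thesis using x by auto
    next
      case True
      obtain y where y: "y \<in> L" "y \<noteq> 0" "\<Delta> s y \<noteq> 0" using pair[of s] insert.prems by auto
      \<comment> \<open>If \<open>x\<close> fails on the new pair, x^n y is tried. On each old pair
        the value n \<Delta>(x) + \<Delta>(y) vanishes for at most one n, so some n avoids all of
        them; on the new pair the value is \<Delta>(y) \<noteq> 0.\<close>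
      have "infinite (range (of_nat :: nat \<Rightarrow> rat))" by (simp add: range_inj_infinite)
      then obtain n where n: "of_nat n \<notin> (\<lambda>s. - \<Delta> s y / \<Delta> s x) ` S"
        using finite_subset[of "range of_nat" "(\<lambda>s. - \<Delta> s y / \<Delta> s x) ` S"] insert.hyps by blast
      have "\<Delta> r (x ^ n * y) \<noteq> 0" if r: "r \<in> S" for r
      proof
        assume "\<Delta> r (x ^ n * y) = 0"
        moreover have "r \<in> W \<times> W" using r insert.prems by blast
        ultimately have "of_nat n * \<Delta> r x + \<Delta> r y = 0" using \<Delta>_mult[of r x y n] x y by simp
        then have "of_nat n = - \<Delta> r y / \<Delta> r x"
          using x(3)[OF r] by (simp add: field_simps add_eq_0_iff)
        then show False using n r by blast
      qed
      moreover have "\<Delta> s (x ^ n * y) \<noteq> 0"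
        using True y x(1,2) insert.prems \<Delta>_mult[of s x y n] by simp
      ultimately show ?thesis
        using x y by (intro bexI[of _ "x ^ n * y"]) (auto intro: L.mult_mem L.power_mem)
    qed
  qed
  from this[of "{s \<in> W \<times> W. fst s \<noteq> snd s}"] obtain x where
    x: "x \<in> L" "x \<noteq> 0" "\<And>s. s \<in> {s \<in> W \<times> W. fst s \<noteq> snd s} \<Longrightarrow> \<Delta> s x \<noteq> 0"
    using finite_W by auto
  then have "inj_on (\<lambda>e. hahn_ord (conj e x)) W"
    by (intro inj_onI) (force simp: \<Delta>_def)
  then show ?thesis using x by blast
qed

lemma valuation_preserving_conj:
  "\<exists>e\<in>W. e \<noteq> 0 \<and> (\<forall>x\<in>L. hahn_val (conj e x) = hahn_val x)"
proof (rule ccontr)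
  assume "\<not> ?thesis"
  then obtain x where x: "x \<in> L" "x \<noteq> 0" "inj_on (\<lambda>e. hahn_ord (conj e x)) W"
    using separating_element by blast
  \<comment> \<open>The orders of the conjugates are distinct, so the minimum is attained once.
    Passing to that conjugate \<open>y\<close> makes the identity the index of the strictly smallest
    order.\<close>
  obtain e0 where e0: "e0 \<in> W" "\<And>e. e \<in> W \<Longrightarrow> hahn_ord (conj e0 x) \<le> hahn_ord (conj e x)"
    using ex_min_if_finite[of "(\<lambda>e. hahn_ord (conj e x)) ` W"] finite_W zero_W by force
  define y where "y = conj e0 x"
  have y: "y \<in> L" "y \<noteq> 0" using x e0 by (simp_all add: y_def conj_mem conj_eq_0_iff)
  have ord_y: "hahn_ord y < hahn_ord (conj e y)" if e: "e \<in> W" "e \<noteq> 0" for e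
  proof -
    have "conj e y = conj (e + e0) x" using x e e0 by (simp add: y_def conj_conj)
    moreover have "hahn_ord (conj (e + e0) x) \<noteq> hahn_ord (conj e0 x)"
      using x(3) e e0(1) add_W[of e e0] by (auto dest: inj_onD)
    ultimately show ?thesis using e0(2)[of "e + e0"] e e0(1) add_W[of e e0] by (simp add: y_def)
  qed
  \<comment> \<open>Values are rational: raising \<open>y\<close> to the denominator makes its value
    an integer a, and t^(-a) in \<open>K\<close> moves it to 0. All conjugates are multiplied by the
    same factor, so the strict inequalities survive.\<close>
  obtain a b where ab: "hahn_ord y = of_int a / of_int b" "b > 0"
    by (metis quotient_of_div quotient_of_denom_pos prod.collapse)
  define n where "n = nat b"
  have n: "of_nat n * hahn_ord y = of_int a" "n > 0" using ab by (simp_all add: n_def)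
  define k where "k = (hahn_monom 1 (of_int (- a)) :: 'k hahn)"
  have k: "k \<in> K" "k \<in> L" "k \<noteq> 0" "hahn_ord k = - of_int a"
    using t_power_mem[of "- a"] K_sub_L by (auto simp: k_def hahn_monom_eq_0_iff hahn_ord_monom)
  define z where "z = y ^ n * k"
  have z: "z \<in> L" "z \<noteq> 0" "hahn_ord z = 0"
    using y k n by (auto simp: z_def L.mult_mem L.power_mem hahn_ord_mult hahn_ord_power)
  have conj_z: "conj e z = conj e y ^ n * k" if "e \<in> W" for e
    using that y k by (simp add: z_def conj_mult conj_power conj_base L.power_mem)
  have ord_z: "0 < hahn_ord (conj e z)" if e: "e \<in> W" "e \<noteq> 0" for e
    using ord_y[OF e] n y k e
      mult_strict_left_mono[of "hahn_ord y" "hahn_ord (conj e y)" "of_nat n"]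
    by (simp add: conj_z hahn_ord_mult hahn_ord_power conj_eq_0_iff)
  \<comment> \<open>Dividing by the residue of \<open>z\<close> gives residue 1 to \<open>c\<close>
    and leaves residue 0 to its other conjugates.\<close>
  define r where "r = hahn_coeff z 0"
  have "r \<noteq> 0" using coeff_hahn_ord[OF z(2)] z(3) by (simp add: r_def)
  define c where "c = hahn_const (1 / r) * z"
  have c: "c \<in> L" using z const_mem K_sub_L by (auto simp: c_def intro: L.mult_mem)
  have conj_c: "conj e c = hahn_const (1 / r) * conj e z" if "e \<in> W" for e
    using that z const_mem K_sub_L by (simp add: c_def conj_mult conj_base subset_iff)
  have val_z: "0 \<le> hahn_val (conj e z)" "e \<noteq> 0 \<Longrightarrow> 0 < hahn_val (conj e z)" if e: "e \<in> W" for e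
    using z ord_z[of e] e conj_0[of z]
    by (cases "e = 0"; simp add: hahn_val_ord conj_eq_0_iff zero_extended_def less_imp_le)+
  have int_c: "supp_ge 0 (conj e c)" if "e \<in> W" for e
    using val_z(1)[OF that] by (simp add: conj_c that hahn_val_ge_0_iff supp_ge_def hahn_monom_mult_coeff)
  have res_c: "hahn_coeff (conj e c) 0 = (if e = 0 then 1 else 0)" if e: "e \<in> W" for e
    using val_z(2)[OF e] e \<open>r \<noteq> 0\<close> z
    by (auto simp: conj_c hahn_monom_mult_coeff r_def conj_0 hahn_val_gt_0_iff)
  \<comment> \<open>\<open>G W\<close> is the characteristic polynomial of \<open>c\<close>, and
    \<open>G (W - {0})\<close> is the cofactor of its factor X - c.\<close>
  define G where "G A = (\<Prod>e\<in>A. [:- conj e c, 1:])" for A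
  have int_G: "supp_ge 0 (coeff (G A) i)" if "A \<subseteq> W" for A i
    unfolding G_def using that int_c by (intro supp_ge_0_coeff_linear_prod) auto
  have int_1: "supp_ge 0 (1 - conj e c)" if "e \<in> W" for e
    using int_c[OF that] by (intro supp_ge_diff) simp_all
  have poly_G: "poly (G A) 1 = (\<Prod>e\<in>A. 1 - conj e c)" for A
    by (simp add: G_def poly_prod)
  have G_W: "G W = [:- c, 1:] * G (W - {0})"
    unfolding G_def using prod.remove[OF finite_W zero_W, of "\<lambda>e. [:- conj e c, 1:]"] c
    by (simp only: conj_0)
  have "coeff (G W) i \<in> val_ring hahn_val K" for i
    using int_G[of W i] polys_over_coeff[OF prod_conj_over[OF c]]
    by (simp add: val_ring_def hahn_val_ge_0_iff G_def)
  moreover have "1 \<in> val_ring hahn_val K"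
    by (simp add: val_ring_def hahn_val_ge_0_iff)
  moreover have "0 < hahn_val (poly (G W) 1)"
    unfolding hahn_val_gt_0_iff poly_G using int_1 zero_W finite_W res_c[OF zero_W]
    by (auto simp: coeff_0_prod supp_ge_0_prod minus_hahn.rep_eq coeff_0_1)
  \<comment> \<open>By the product rule the derivative at 1 is (1 - c) d plus the cofactor at 1. The
    first summand has residue 0 because \<open>d\<close> is integral, the second has residue
    1.\<close>
  moreover have "hahn_val (poly (pderiv (G W)) 1) = 0"
  proof -
    define d where "d = poly (pderiv (G (W - {0}))) 1"
    have "supp_ge 0 d"
      unfolding d_def poly_altdef coeff_pderiv
      using int_G[of "W - {0}"]
      by (intro supp_ge_sum) (simp add: supp_ge_def of_nat_hahn hahn_monom_mult_coeff flip: of_nat_Suc)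
    have "poly (pderiv (G W)) 1 = (1 - c) * d + poly (G (W - {0})) 1"
      unfolding G_W pderiv_mult by (simp add: pderiv_pCons d_def algebra_simps)
    moreover have "supp_ge 0 (1 - c)" "hahn_coeff (1 - c) 0 = 0"
      using int_1[OF zero_W] res_c[OF zero_W] c by (simp_all add: conj_0 minus_hahn.rep_eq coeff_0_1)
    moreover have "supp_ge 0 (poly (G (W - {0})) 1)"
      unfolding poly_G using int_1 by (intro supp_ge_0_prod) auto
    moreover have "hahn_coeff (poly (G (W - {0})) 1) 0 = 1"
      unfolding poly_G using int_1 res_c
      by (subst coeff_0_prod) (auto simp: minus_hahn.rep_eq coeff_0_1)
    ultimately show ?thesis
      using \<open>supp_ge 0 d\<close>
      by (simp add: hahn_val_eq_0_iff supp_ge_add supp_ge_0_mult plus_hahn.rep_eq coeff_0_mult)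
  qed
  ultimately obtain b where b: "b \<in> val_ring hahn_val K" "poly (G W) b = 0"
    using hensel unfolding henselian_def by blast
  \<comment> \<open>The zeros of \<open>G W\<close> are the conjugates of \<open>c\<close>. A
    conjugate lying in \<open>K\<close> is fixed by the inverse translation, so \<open>c\<close>
    itself lies in \<open>K\<close> and all its conjugates have equal residue, against
    \<open>res_c\<close>.\<close>
  then obtain e where e: "e \<in> W" "b = conj e c"
    using finite_W by (auto simp: G_def poly_prod)
  have "b \<in> K" using b by (simp add: val_ring_def)
  then have "c = b"
    using e c conj_uminus[of c e] conj_base[of b "- e"] uminus_W[of e] by simp
  moreover obtain e1 where e1: "e1 \<in> W" "e1 \<noteq> 0" by (rule nonzero_W)
  ultimately have "conj e1 c = conj 0 c" using \<open>b \<in> K\<close> c by (simp add: conj_base conj_0)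
  then show False using res_c[OF e1(1)] res_c[OF zero_W] e1(2) by simp
qed

end

section \<open>The Galois group\<close>

lemma ring_hom_type_algebra_iff:
  fixes \<sigma> :: "'a::field \<Rightarrow> 'a"
  shows "\<sigma> \<in> Ring.ring_hom (ring_of_type_algebra\<lparr>carrier := L\<rparr>) (ring_of_type_algebra\<lparr>carrier := L\<rparr>) \<longleftrightarrow>
    \<sigma> \<in> L \<rightarrow> L \<and> (\<forall>x\<in>L. \<forall>y\<in>L. \<sigma> (x * y) = \<sigma> x * \<sigma> y) \<and>
    (\<forall>x\<in>L. \<forall>y\<in>L. \<sigma> (x + y) = \<sigma> x + \<sigma> y) \<and> \<sigma> 1 = 1"
  by (auto simp: Ring.ring_hom_def)

text \<open>The parameter \<open>w\<close> lets one definition cover both groups: a constant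
  \<open>w\<close> gives the full Galois group, \<open>hahn_val\<close> the decomposition group of
  the valuation.\<close>

definition field_auts :: "'a::field set \<Rightarrow> 'a set \<Rightarrow> ('a \<Rightarrow> 'b) \<Rightarrow> ('a \<Rightarrow> 'a) set" where
  "field_auts L K w = {\<sigma> \<in> Bij L.
     \<sigma> \<in> Ring.ring_hom (ring_of_type_algebra\<lparr>carrier := L\<rparr>) (ring_of_type_algebra\<lparr>carrier := L\<rparr>) \<and>
     (\<forall>x\<in>K. \<sigma> x = x) \<and> (\<forall>x\<in>L. w (\<sigma> x) = w x)}"

lemma subgroup_field_auts:
  assumes L: "subfield L (ring_of_type_algebra :: 'a::field ring)" and KL: "K \<subseteq> L"
  shows "subgroup (field_auts L K w) (BijGroup L)"
proof -
  interpret L: type_subfield L by (rule type_subfield.intro) (rule L)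
  interpret B: group "BijGroup L" by (rule group_BijGroup)
  show ?thesis
  proof (rule B.subgroupI)
    show "field_auts L K w \<subseteq> carrier (BijGroup L)"
      by (auto simp: field_auts_def BijGroup_def)
    have "(\<lambda>x\<in>L. x) \<in> field_auts L K w"
      using KL id_Bij[of L]
      by (auto simp: field_auts_def ring_hom_type_algebra_iff L.add_mem L.mult_mem)
    then show "field_auts L K w \<noteq> {}" by blast
  next
    fix \<sigma> assume \<sigma>: "\<sigma> \<in> field_auts L K w"
    then have bij: "\<sigma> \<in> Bij L" "bij_betw \<sigma> L L" by (auto simp: field_auts_def Bij_def)
    define \<tau> where "\<tau> = (\<lambda>x\<in>L. inv_into L \<sigma> x)"
    have inv: "inv\<^bsub>BijGroup L\<^esub> \<sigma> = \<tau>" using inv_BijGroup[OF bij(1)] by (simp add: \<tau>_def)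
    have \<tau>: "\<tau> x \<in> L" "\<sigma> (\<tau> x) = x" "\<tau> (\<sigma> x) = x" if "x \<in> L" for x
      using that bij(2) by (auto simp: \<tau>_def bij_betw_inv_into_right bij_betw_inv_into_left bij_betw_apply
          intro: bij_betw_apply[OF bij_betw_inv_into])
    \<comment> \<open>Identities for the inverse \<tau> are checked after applying the injective
      \<sigma>.\<close>
    have eqI: "x = y" if "x \<in> L" "y \<in> L" "\<sigma> x = \<sigma> y" for x y
      using that bij(2) by (auto simp: bij_betw_def inj_on_def)
    have hom: "\<sigma> (x * y) = \<sigma> x * \<sigma> y" "\<sigma> (x + y) = \<sigma> x + \<sigma> y" "\<sigma> 1 = 1"
      if "x \<in> L" "y \<in> L" for x y
      using \<sigma> that by (auto simp: field_auts_def ring_hom_type_algebra_iff)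
    have "\<tau> (x * y) = \<tau> x * \<tau> y" "\<tau> (x + y) = \<tau> x + \<tau> y" if "x \<in> L" "y \<in> L" for x y
      by (rule eqI; use that in \<open>simp add: \<tau> hom L.add_mem L.mult_mem\<close>)+
    moreover have "\<tau> 1 = 1" using \<tau>(3)[of 1] hom(3)[of 1 1] by simp
    moreover have "\<tau> x = x" if "x \<in> K" for x
      using \<tau>(3)[of x] that KL \<sigma> by (auto simp: field_auts_def)
    moreover have "w (\<tau> x) = w x" if "x \<in> L" for x
      using \<sigma> \<tau>[OF that] by (metis (mono_tags, lifting) field_auts_def mem_Collect_eq)
    moreover have "\<tau> \<in> Bij L" unfolding \<tau>_def by (rule restrict_inv_into_Bij[OF bij(1)])
    ultimately show "inv\<^bsub>BijGroup L\<^esub> \<sigma> \<in> field_auts L K w"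
      using \<tau>(1) unfolding inv by (simp add: field_auts_def ring_hom_type_algebra_iff)
  next
    fix \<sigma> \<tau> assume *: "\<sigma> \<in> field_auts L K w" "\<tau> \<in> field_auts L K w"
    then have bij: "\<sigma> \<in> Bij L" "\<tau> \<in> Bij L" by (auto simp: field_auts_def)
    have mult: "\<sigma> \<otimes>\<^bsub>BijGroup L\<^esub> \<tau> = compose L \<sigma> \<tau>" using bij by (simp add: BijGroup_def)
    have mem: "\<sigma> x \<in> L" "\<tau> x \<in> L" if "x \<in> L" for x
      using that bij Bij_imp_funcset by blast+
    show "\<sigma> \<otimes>\<^bsub>BijGroup L\<^esub> \<tau> \<in> field_auts L K w"
      using * mem KL compose_Bij[OF bij] unfolding mult
      by (auto simp: field_auts_def ring_hom_type_algebra_iff compose_eq L.add_mem L.mult_mem subset_iff)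
  qed
qed

lemma carrier_gal_group: "carrier (gal_group L K) = field_auts L K (\<lambda>_. ())"
  by (simp add: gal_group_def field_auts_def)

lemma one_gal_group: "\<one>\<^bsub>gal_group L K\<^esub> = (\<lambda>x\<in>L. x)"
  by (simp add: gal_group_def BijGroup_def)

lemma subgroup_gal_group:
  assumes "subfield L (ring_of_type_algebra :: 'a::field ring)" "K \<subseteq> L"
  shows "subgroup (field_auts L K w) (gal_group L K)"
proof -
  have "gal_group L K = BijGroup L\<lparr>carrier := field_auts L K (\<lambda>_. ())\<rparr>"
    by (simp add: gal_group_def field_auts_def)
  moreover have "field_auts L K w \<subseteq> field_auts L K (\<lambda>_. ())"
    by (auto simp: field_auts_def)
  ultimately show ?thesis
    using group.subgroup_incl[OF group_BijGroup subgroup_field_auts[OF assms] subgroup_field_auts[OF assms]]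
    by metis
qed

lemma field_aut_poly:
  assumes "subfield L (ring_of_type_algebra :: 'a::field ring)" "K \<subseteq> L" "subfield K (ring_of_type_algebra :: 'a ring)"
    and \<sigma>: "\<sigma> \<in> field_auts L K w" and x: "x \<in> L" and f: "f \<in> polys_over K"
  shows "\<sigma> (poly f x) = poly f (\<sigma> x)"
proof -
  interpret L: type_subfield L by (rule type_subfield.intro) (rule assms)
  interpret K: type_subfield K by (rule type_subfield.intro) (rule assms)
  have hom: "\<sigma> (x * y) = \<sigma> x * \<sigma> y" "\<sigma> (x + y) = \<sigma> x + \<sigma> y"
    if "x \<in> L" "y \<in> L" for x y
    using \<sigma> that by (auto simp: field_auts_def ring_hom_type_algebra_iff)
  have fixK: "\<sigma> a = a" if "a \<in> K" for a using that \<sigma> by (auto simp: field_auts_def)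
  have "poly f x \<in> L \<and> \<sigma> (poly f x) = poly f (\<sigma> x)"
    using f
  proof (induction f)
    case 0
    then show ?case using fixK[of 0] by simp
  next
    case (pCons a f)
    then have "a \<in> K" "a \<in> L" using assms(2) by auto
    then show ?case using pCons x by (simp add: hom fixK L.add_mem L.mult_mem)
  qed
  then show ?thesis by simp
qed

section \<open>Automorphisms of \<open>L\<close> are determined by the image of \<theta>\<close>

context translation_extension
begin

lemma field_aut_eqI:
  assumes "\<sigma> \<in> field_auts L K w" "\<sigma> \<theta> = \<theta>"
  shows "\<sigma> = (\<lambda>x\<in>L. x)"
proof
  fix x
  show "\<sigma> x = (\<lambda>x\<in>L. x) x"
  proof (cases "x \<in> L")
    case True
    then show ?thesis
      using field_aut_poly[OF subfield_L K_sub_L subfield_K assms(1) theta_mem_L] assms(2)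
      by (auto simp: L_def)
  next
    case False
    then show ?thesis using assms(1) by (auto simp: field_auts_def Bij_def extensional_def)
  qed
qed

lemma restrict_conj_field_aut:
  assumes e: "e \<in> W" and w: "\<And>x. x \<in> L \<Longrightarrow> w (conj e x) = w x"
  shows "restrict (conj e) L \<in> field_auts L K w"
proof -
  have "bij_betw (restrict (conj e) L) L L"
  proof (rule bij_betw_byWitness[of _ "conj (- e)"])
    show "\<forall>x\<in>L. conj (- e) (restrict (conj e) L x) = x"
      using e by (simp add: conj_uminus)
    show "\<forall>x\<in>L. restrict (conj e) L (conj (- e) x) = x"
      using e conj_uminus[of _ "- e"] by (simp add: conj_mem uminus_W)
    show "restrict (conj e) L ` L \<subseteq> L" "conj (- e) ` L \<subseteq> L"
      using e by (auto simp: conj_mem uminus_W)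
  qed
  then have "restrict (conj e) L \<in> Bij L" by (simp add: Bij_def)
  moreover have "restrict (conj e) L x = x" if "x \<in> K" for x
    using that K_sub_L e by (auto simp: conj_base)
  ultimately show ?thesis
    using e w K_sub_L
    by (simp add: field_auts_def ring_hom_type_algebra_iff conj_add conj_mult conj_mem conj_base
        L.add_mem L.mult_mem)
qed

end

section \<open>Ramification ideals\<close>

locale hahn_translation_extension_char = hahn_translation_extension +
  assumes prime_char: "prime CHAR('a)"
    and aut_translates: "\<sigma> \<in> carrier (gal_group L K) \<Longrightarrow> \<sigma> \<theta> - \<theta> \<in> range hahn_const"
    and approx: "0 < g \<Longrightarrow> \<exists>k\<in>K. \<exists>h. hahn_val (\<theta> - k) = Fin h \<and> - g \<le> h"
begin

text \<open>For b = \<theta> - k the numerator \<sigma> b - b = \<sigma> \<theta> - \<theta> is a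
  nonzero constant, so the quotient by \<open>b\<close> has value -v(b). By \<open>approx\<close>
  this can be made at most the positive value of any given \<open>c\<close>.\<close>

lemma max_ideal_subset_ram_I:
  assumes \<sigma>: "\<sigma> \<in> carrier (gal_group L K)" "\<sigma> \<noteq> \<one>\<^bsub>gal_group L K\<^esub>"
  shows "val_max_ideal hahn_val L \<subseteq> ram_I hahn_val L \<sigma>"
proof
  fix c assume c: "c \<in> val_max_ideal hahn_val L"
  show "c \<in> ram_I hahn_val L \<sigma>"
  proof (cases "c = 0")
    case True
    show ?thesis
      unfolding ram_I_def True by (intro CollectI conjI bexI[of _ 1]) (simp_all add: hahn_val_def)
  next
    case False
    then have cv: "hahn_val c = Fin (hahn_ord c)" "0 < hahn_ord c" "c \<in> L"
      using c by (auto simp: val_max_ideal_def hahn_val_ord zero_extended_def)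
    obtain k h where k: "k \<in> K" "hahn_val (\<theta> - k) = Fin h" "- hahn_ord c \<le> h"
      using approx[OF cv(2)] by blast
    define b where "b = \<theta> - k"
    have b: "b \<in> L" "b \<noteq> 0"
      using k theta_mem_L theta_notin K_sub_L by (auto simp: b_def intro!: L.diff_mem)
    obtain r where r: "\<sigma> \<theta> - \<theta> = hahn_const r" using aut_translates[OF \<sigma>(1)] by blast
    have auts: "\<sigma> \<in> field_auts L K (\<lambda>_. ())" using \<sigma>(1) by (simp add: carrier_gal_group)
    have "\<sigma> \<theta> \<noteq> \<theta>" using field_aut_eqI[OF auts] \<sigma>(2) by (auto simp: one_gal_group)
    then have r0: "r \<noteq> 0" using r hahn_monom_eq_0_iff[of r 0] by auto
    \<comment> \<open>That \<sigma> commutes with subtracting \<open>k\<close> is read off from the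
      polynomial X - k over \<open>K\<close>.\<close>
    have "\<sigma> (poly [:- k, 1:] \<theta>) = poly [:- k, 1:] (\<sigma> \<theta>)"
      by (rule field_aut_poly[OF subfield_L K_sub_L subfield_K auts theta_mem_L])
        (simp add: k uminus_mem)
    then have "\<sigma> b - b = hahn_const r" by (simp add: b_def r[symmetric])
    then have "hahn_val ((\<sigma> b - b) / b * b) = Fin 0"
      using b r0 by (simp add: hahn_val_monom)
    moreover have nz: "(\<sigma> b - b) / b \<noteq> 0" using \<open>\<sigma> b - b = _\<close> b r0 by (simp add: hahn_monom_eq_0_iff)
    ultimately have "hahn_ord ((\<sigma> b - b) / b) + h = 0"
      using b k(2) unfolding hahn_val_mult by (simp add: hahn_val_ord b_def)
    then have "hahn_val ((\<sigma> b - b) / b) \<le> hahn_val c"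
      using k(3) nz by (simp add: cv hahn_val_ord)
    then show ?thesis using b cv(3) by (auto simp: ram_I_def)
  qed
qed

text \<open>Iterating \<open>\<sigma> b = r b + \<dots>\<close> with \<open>\<sigma>\<close> of order \<open>p\<close> gives \<open>r\<^sup>p = 1\<close>, so \<open>r = 1\<close> because
  a field of characteristic \<open>p\<close> has no nontrivial \<open>p\<close>-th roots of unity.\<close>

lemma ram_I_subset_max_ideal:
  assumes \<sigma>: "\<sigma> \<in> field_auts L K hahn_val"
  shows "ram_I hahn_val L \<sigma> \<subseteq> val_max_ideal hahn_val L"
proof
  define p where "p = CHAR('a)"
  have \<sigma>_mem: "\<sigma> x \<in> L" if "x \<in> L" for x
    using \<sigma> that by (auto simp: field_auts_def ring_hom_type_algebra_iff)
  have hom: "\<sigma> (x * y) = \<sigma> x * \<sigma> y" "\<sigma> (x + y) = \<sigma> x + \<sigma> y" if "x \<in> L" "y \<in> L" for x y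
    using \<sigma> that by (auto simp: field_auts_def ring_hom_type_algebra_iff)
  have fixK: "\<sigma> x = x" if "x \<in> K" for x using \<sigma> that by (auto simp: field_auts_def)
  have \<sigma>_val: "hahn_val (\<sigma> x) = hahn_val x" if "x \<in> L" for x
    using \<sigma> that by (auto simp: field_auts_def)
  have hom_diff: "\<sigma> (x - y) = \<sigma> x - \<sigma> y" if "x \<in> L" "y \<in> L" for x y
    using hom(2)[of "x - y" y] that by (simp add: L.diff_mem)
  have "\<sigma> \<in> carrier (gal_group L K)" using \<sigma> by (simp add: carrier_gal_group field_auts_def)
  then obtain s where s: "\<sigma> \<theta> - \<theta> = hahn_const s" using aut_translates by blast
  \<comment> \<open>The constant \<open>s\<close> lies in \<open>K\<close>, so each application of
    \<sigma> adds it once more to \<theta>; after p applications p s = 0, whence \<sigma>^p is the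
    identity on \<open>L\<close>.\<close>
  have iter: "(\<sigma> ^^ n) (poly f \<theta>) = poly f (\<theta> + of_nat n * hahn_const s)"
    if f: "f \<in> polys_over K" for n f
  proof (induction n)
    case (Suc n)
    have e: "of_nat n * hahn_const s \<in> K" by (intro mult_mem of_nat_mem const_mem)
    have "\<sigma> (poly (f \<circ>\<^sub>p [:of_nat n * hahn_const s, 1:]) \<theta>) =
        poly (f \<circ>\<^sub>p [:of_nat n * hahn_const s, 1:]) (\<sigma> \<theta>)"
      by (rule field_aut_poly[OF subfield_L K_sub_L subfield_K \<sigma> theta_mem_L translate_over[OF f e]])
    then show ?case using Suc s unfolding poly_translate by (simp add: algebra_simps)
  qed simp
  have order_p: "(\<sigma> ^^ p) x = x" if "x \<in> L" for x
    using that iter[of _ p] of_nat_CHAR[where ?'a = "'a hahn"] by (auto simp: L_def p_def)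
  have pow_mem: "(\<sigma> ^^ n) x \<in> L" if "x \<in> L" for x n
    by (induction n) (simp_all add: that \<sigma>_mem)
  fix c assume "c \<in> ram_I hahn_val L \<sigma>"
  then obtain b where b: "c \<in> L" "b \<in> L" "b \<noteq> 0" "hahn_val ((\<sigma> b - b) / b) \<le> hahn_val c"
    by (auto simp: ram_I_def)
  define g where "g = hahn_ord b"
  have val_b: "hahn_val b = Fin g" "hahn_val (\<sigma> b) = Fin g" using b \<sigma>_val by (simp_all add: g_def hahn_val_ord)
  define r where "r = hahn_coeff (\<sigma> b) g / hahn_coeff b g"
  have coeffs: "hahn_coeff b g \<noteq> 0" "hahn_coeff (\<sigma> b) g = r * hahn_coeff b g"
    using val_b by (simp_all add: hahn_val_eq_Fin r_def)
  have step: "Fin g < hahn_val (\<sigma> b - hahn_const r * b)"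
    using val_b coeffs unfolding Fin_less_hahn_val hahn_val_eq_Fin supp_ge_def
    by (auto simp: minus_hahn.rep_eq hahn_monom_mult_coeff order.order_iff_strict)
  \<comment> \<open>In the induction step the error splits into \<sigma> of the old error, of
    unchanged value since \<sigma> preserves the valuation, and a constant multiple of the error of
    \<open>step\<close>.\<close>
  have "Fin g < hahn_val ((\<sigma> ^^ n) b - hahn_const (r ^ n) * b)" for n
  proof (induction n)
    case 0
    show ?case by (simp add: Fin_less_hahn_val zero_hahn.rep_eq flip: one_hahn_def)
  next
    case (Suc n)
    let ?y = "(\<sigma> ^^ n) b - hahn_const (r ^ n) * b"
    have mem: "hahn_const (r ^ n) * b \<in> L" "hahn_const (r ^ n) \<in> L" "?y \<in> L"
      using b const_mem K_sub_L pow_mem by (auto intro!: L.mult_mem L.diff_mem)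
    have eq: "(\<sigma> ^^ Suc n) b - hahn_const (r ^ Suc n) * b =
        \<sigma> ?y + hahn_const (r ^ n) * (\<sigma> b - hahn_const r * b)"
      using mem b pow_mem const_mem
      by (simp add: hom_diff hom fixK algebra_simps hahn_monom_mult_monom flip: mult.assoc)
    have "Fin g < hahn_val (\<sigma> ?y)" using Suc \<sigma>_val mem by simp
    then show ?case
      using step unfolding eq Fin_less_hahn_val by (simp add: plus_hahn.rep_eq hahn_monom_mult_coeff)
  qed
  from this[of p] have "hahn_coeff (b - hahn_const (r ^ p) * b) g = 0"
    using order_p[OF b(2)] unfolding Fin_less_hahn_val by simp
  then have "hahn_coeff b g = r ^ p * hahn_coeff b g"
    by (simp add: minus_hahn.rep_eq hahn_monom_mult_coeff)
  then have "r ^ p = 1" using coeffs by simp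
  moreover have "(r - 1 + 1) ^ p = (r - 1) ^ p + 1 ^ p"
    unfolding p_def by (rule freshmans_dream[OF prime_char refl])
  ultimately have "r = 1" by simp
  then have "Fin g < hahn_val (\<sigma> b - b)" using step by (simp flip: one_hahn_def)
  moreover have "hahn_val (\<sigma> b - b) = hahn_val ((\<sigma> b - b) / b) + Fin g"
    using b hahn_val_mult[of "(\<sigma> b - b) / b" b] by (simp add: val_b)
  ultimately have "Fin g < hahn_val ((\<sigma> b - b) / b) + Fin g" by simp
  moreover have "0 < w" if "Fin g < w + Fin g" for w :: "rat extended"
    using that by (cases w) (simp_all add: zero_extended_def)
  ultimately have "0 < hahn_val ((\<sigma> b - b) / b)" by blast
  then show "c \<in> val_max_ideal hahn_val L" using b by (simp add: val_max_ideal_def)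
qed

text \<open>A ramification ideal lies in the maximal ideal by definition and contains it by
  \<open>sub\<close>, which settles uniqueness. The valuation-preserving subgroup \<open>H\<close>
  shows that the maximal ideal does occur.\<close>

theorem ramification_ideals_eq: "ramification_ideals hahn_val L K = {val_max_ideal hahn_val L}"
proof -
  have sub: "val_max_ideal hahn_val L \<subseteq> ram_I_subgroup hahn_val L H"
    if H: "subgroup H (gal_group L K)" "H \<noteq> {\<one>\<^bsub>gal_group L K\<^esub>}" for H
  proof -
    obtain \<sigma> where "\<sigma> \<in> H" "\<sigma> \<noteq> \<one>\<^bsub>gal_group L K\<^esub>"
      using H subgroup.one_closed[OF H(1)] by blast
    then show ?thesis
      using max_ideal_subset_ram_I subgroup.mem_carrier[OF H(1)] by (fastforce simp: ram_I_subgroup_def)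
  qed
  define H where "H = field_auts L K (hahn_val :: 'a hahn \<Rightarrow> _)"
  have H: "subgroup H (gal_group L K)"
    unfolding H_def by (rule subgroup_gal_group[OF subfield_L K_sub_L])
  obtain e where e: "e \<in> W" "e \<noteq> 0" "\<And>x. x \<in> L \<Longrightarrow> hahn_val (conj e x) = hahn_val x"
    using valuation_preserving_conj by blast
  have "restrict (conj e) L \<in> H" unfolding H_def using e by (intro restrict_conj_field_aut) auto
  moreover have "restrict (conj e) L \<theta> \<noteq> \<one>\<^bsub>gal_group L K\<^esub> \<theta>"
    using e by (simp add: one_gal_group theta_mem_L conj_theta)
  ultimately have nontriv: "H \<noteq> {\<one>\<^bsub>gal_group L K\<^esub>}" by (metis singletonD)
  have "ram_I_subgroup hahn_val L H \<subseteq> val_max_ideal hahn_val L"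
    using ram_I_subset_max_ideal by (auto simp: ram_I_subgroup_def H_def)
  with sub[OF H nontriv] have "ram_I_subgroup hahn_val L H = val_max_ideal hahn_val L" by blast
  then have "val_max_ideal hahn_val L \<in> Ram hahn_val L K"
    using H nontriv unfolding Ram_def by blast
  then have "val_max_ideal hahn_val L \<in> ramification_ideals hahn_val L K"
    by (simp add: ramification_ideals_def)
  moreover have "I = val_max_ideal hahn_val L" if "I \<in> ramification_ideals hahn_val L K" for I
    using that sub unfolding ramification_ideals_def Ram_def by blast
  ultimately show ?thesis by blast
qed

end

section \<open>The Artin-Schreier map\<close>

definition artin_schreier :: "'a::comm_ring_1 \<Rightarrow> 'a" where
  "artin_schreier x = x ^ CHAR('a) - x"

lemma power_char_diff:
  fixes x y :: "'a::comm_ring_1"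
  assumes "prime CHAR('a)"
  shows "(x - y) ^ CHAR('a) = x ^ CHAR('a) - y ^ CHAR('a)"
  using freshmans_dream[OF assms refl, of "x - y" y] by (simp add: algebra_simps)

text \<open>Fermat's little theorem, by induction through the additivity of Frobenius.\<close>

lemma power_char_of_nat:
  assumes "prime CHAR('a::comm_ring_1)"
  shows "of_nat n ^ CHAR('a) = (of_nat n :: 'a)"
proof (induction n)
  case 0
  then show ?case using prime_gt_0_nat[OF assms] by (simp add: power_0_left)
next
  case (Suc n)
  then show ?case using freshmans_dream[OF assms refl, of 1 "of_nat n"] by simp
qed

text \<open>The difference of the two powers is (x - y)^p, which vanishes in a domain only for x =
  y.\<close>

lemma power_char_eq_iff:
  fixes x y :: "'a::idom"
  assumes "prime CHAR('a)"
  shows "x ^ CHAR('a) = y ^ CHAR('a) \<longleftrightarrow> x = y"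
  using power_char_diff[OF assms, of x y] by auto

lemma artin_schreier_add:
  fixes x y :: "'a::comm_ring_1"
  assumes "prime CHAR('a)"
  shows "artin_schreier (x + y) = artin_schreier x + artin_schreier y"
  unfolding artin_schreier_def freshmans_dream[OF assms refl] by simp

lemma artin_schreier_diff:
  fixes x y :: "'a::comm_ring_1"
  assumes "prime CHAR('a)"
  shows "artin_schreier (x - y) = artin_schreier x - artin_schreier y"
  unfolding artin_schreier_def power_char_diff[OF assms] by simp

lemma artin_schreier_of_nat_mult:
  fixes x :: "'a::comm_ring_1"
  assumes "prime CHAR('a)"
  shows "artin_schreier (of_nat n * x) = of_nat n * artin_schreier x"
  by (simp add: artin_schreier_def power_mult_distrib power_char_of_nat[OF assms] algebra_simps)

lemma artin_schreier_of_nat: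
  assumes "prime CHAR('a::comm_ring_1)"
  shows "artin_schreier (of_nat n :: 'a) = 0"
  by (simp add: artin_schreier_def power_char_of_nat[OF assms])

lemma inj_on_of_nat_char: "inj_on (of_nat :: nat \<Rightarrow> 'a::comm_ring_1) {..<CHAR('a)}"
  by (auto simp: inj_on_def of_nat_eq_iff_cong_CHAR cong_def)

lemma degree_power_diff:
  fixes f :: "'a::idom poly"
  assumes "1 < n" "0 < degree f"
  shows "degree (f ^ n - f) = n * degree f"
proof -
  have "degree (f ^ n) = n * degree f" by (rule Polynomial.degree_power_eq) (use assms in auto)
  moreover have "degree f < n * degree f" using assms by simp
  ultimately show ?thesis using degree_add_eq_left[of "- f" "f ^ n"] by simp
qed

lemma degree_diff_const: "0 < degree f \<Longrightarrow> degree (f - [:c:]) = degree f"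
  for f :: "'a::ab_group_add poly"
  unfolding diff_conv_add_uminus by (rule degree_add_eq_left) simp

text \<open>The p elements of the prime field are already zeros of X^p - X; a further zero would
  exceed the degree.\<close>

lemma artin_schreier_eq_0_imp:
  fixes x :: "'a::field"
  assumes p: "prime CHAR('a)" and x: "artin_schreier x = 0"
  shows "x \<in> range of_nat"
proof (rule ccontr)
  assume notin: "x \<notin> range of_nat"
  let ?f = "[:0, 1:] ^ CHAR('a) - [:0, 1:] :: 'a poly"
  let ?R = "insert x (of_nat ` {..<CHAR('a)})"
  have deg: "degree ?f = CHAR('a)"
    using degree_power_diff[of "CHAR('a)" "[:0, 1 :: 'a:]"] prime_gt_1_nat[OF p] by simp
  then have "?f \<noteq> 0" using prime_gt_0_nat[OF p] by auto
  have poly: "poly ?f y = artin_schreier y" for y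
    by (simp add: artin_schreier_def poly_power)
  have "?R \<subseteq> {y. poly ?f y = 0}"
    unfolding poly using x artin_schreier_of_nat[OF p] by auto
  then have "card ?R \<le> card {y. poly ?f y = 0}"
    by (rule card_mono[OF poly_roots_finite[OF \<open>?f \<noteq> 0\<close>]])
  also have "\<dots> \<le> CHAR('a)" using card_poly_roots_bound[OF \<open>?f \<noteq> 0\<close>] deg by simp
  finally show False
    using notin card_image[OF inj_on_of_nat_char[where 'a = 'a]] by (subst (asm) card_insert_disjoint) auto
qed

lemma artin_schreier_surj:
  fixes c :: "'a::alg_closed_field"
  assumes p: "prime CHAR('a)"
  obtains d where "artin_schreier d = c"
proof -
  let ?f = "[:0, 1:] ^ CHAR('a) - [:0, 1:] :: 'a poly"
  have "degree ?f = CHAR('a)"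
    using degree_power_diff[of "CHAR('a)" "[:0, 1 :: 'a:]"] prime_gt_1_nat[OF p] by simp
  then have "0 < degree (?f - [:c:])"
    using prime_gt_0_nat[OF p] degree_diff_const[of ?f c] by simp
  then obtain d where "poly (?f - [:c:]) d = 0"
    using alg_closed_imp_poly_has_root by blast
  then show ?thesis by (intro that[of d]) (simp add: artin_schreier_def poly_power)
qed

lemma artin_schreier_hahn_const:
  "artin_schreier (hahn_const c :: 'a::comm_ring_1 hahn) = hahn_const (artin_schreier c)"
proof -
  have "hahn_const c ^ n = (hahn_const (c ^ n) :: 'a hahn)" for n
    by (induction n) (simp_all add: one_hahn_def hahn_monom_mult_monom)
  then show ?thesis
    by (intro hahn_eqI) (simp add: artin_schreier_def minus_hahn.rep_eq hahn_monom.rep_eq)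
qed

text \<open>Over an algebraically closed field the constant is the Artin-Schreier image of a
  constant d, and x - d then lies in the prime field.\<close>

lemma artin_schreier_eq_const_imp:
  fixes x :: "'k::alg_closed_field hahn"
  assumes p: "prime CHAR('k)" and x: "artin_schreier x \<in> range hahn_const"
  shows "x \<in> range hahn_const"
proof -
  obtain c where c: "artin_schreier x = hahn_const c" using x by blast
  obtain d where d: "artin_schreier d = c" using artin_schreier_surj[OF p] by blast
  have "artin_schreier (x - hahn_const d) = 0"
    using p by (simp add: artin_schreier_diff artin_schreier_hahn_const c d)
  then obtain n where "x - hahn_const d = of_nat n"
    using artin_schreier_eq_0_imp[of "x - hahn_const d"] p by auto
  then have "x = hahn_const (of_nat n + d)"
    by (intro hahn_eqI) (simp add: of_nat_hahn diff_eq_eq plus_hahn.rep_eq hahn_monom.rep_eq)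
  then show ?thesis by blast
qed

text \<open>An integral \<open>x\<close> would have an integral image. So h = v(x) is negative, p h
  < h, and the term x^p dominates, giving g = p h.\<close>

lemma hahn_val_artin_schreier:
  fixes x :: "'k::field hahn"
  assumes p: "prime CHAR('k)" and x: "hahn_val (artin_schreier x) = Fin g" "g < 0"
  shows "hahn_val x = Fin (g / of_nat CHAR('k))"
proof -
  define p where "p = (of_nat CHAR('k) :: rat)"
  have p1: "1 < p" using prime_gt_1_nat[OF p] by (simp add: p_def)
  have as: "artin_schreier x = x ^ CHAR('k) - x" by (simp add: artin_schreier_def)
  have "\<not> supp_ge 0 x"
  proof
    assume "supp_ge 0 x"
    then have "supp_ge 0 (artin_schreier x)"
      unfolding as using supp_ge_power[of 0 x "CHAR('k)"] by (simp add: supp_ge_diff)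
    then show False using x by (auto simp: hahn_val_eq_Fin supp_ge_def)
  qed
  then have "x \<noteq> 0" by auto
  define h where "h = hahn_ord x"
  have h: "hahn_coeff x h \<noteq> 0" "supp_ge h x"
    using \<open>x \<noteq> 0\<close> hahn_val_ord[of x] by (simp_all add: h_def hahn_val_eq_Fin)
  have "h < 0" using \<open>\<not> supp_ge 0 x\<close> h(2) supp_ge_mono[of h x 0] by force
  then have ph: "p * h < h" using p1 by simp
  have "hahn_val (x ^ CHAR('k)) = Fin (p * h)"
    using \<open>x \<noteq> 0\<close> by (simp add: hahn_val_ord hahn_ord_power p_def h_def)
  then have "hahn_val (artin_schreier x) = Fin (p * h)"
    using h ph unfolding as hahn_val_eq_Fin supp_ge_def by (simp add: minus_hahn.rep_eq)
  then have "g = p * h" using x by simp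
  then have "g / p = h" using p1 by simp
  then show ?thesis using \<open>x \<noteq> 0\<close> by (simp add: hahn_val_ord h_def p_def)
qed

section \<open>The two-step Artin-Schreier tower\<close>

locale artin_schreier_tower = type_subfield K for K :: "'k::alg_closed_field hahn set" +
  fixes \<alpha> \<theta> :: "'k hahn"
  assumes prime_char: "prime CHAR('k)"
    and const_mem: "hahn_const c \<in> K" and t_mem: "hahn_t \<in> K"
    and perfect: "perfect_subfield K" and hensel: "henselian hahn_val K"
    and no_limits: "no_finite_limits K"
    and alpha: "artin_schreier \<alpha> = inverse hahn_t"
    and theta: "artin_schreier \<theta> = \<alpha>"
begin

lemma prime_char_hahn: "prime CHAR('k hahn)"
  using prime_char by simp

lemmas artin_schreier_simps = artin_schreier_add[OF prime_char_hahn] artin_schreier_diff[OF prime_char_hahn]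
  artin_schreier_of_nat_mult[OF prime_char_hahn] artin_schreier_of_nat[OF prime_char_hahn]

section \<open>Expansions of \<alpha> and \<theta> in the powers t^(-1/p^n)\<close>

definition r :: "nat \<Rightarrow> 'k hahn" where
  "r n = hahn_monom 1 (- 1 / of_nat (CHAR('k) ^ n))"

lemma p_gt_1: "1 < CHAR('k)"
  using prime_char by (rule prime_gt_1_nat)

lemma r_0: "r 0 = inverse hahn_t"
proof -
  have "hahn_t * r 0 = 1" by (simp add: r_def hahn_monom_mult_monom one_hahn_def)
  then show ?thesis by (metis inverse_unique)
qed

lemma r_power: "r (Suc n) ^ CHAR('k) = r n"
proof -
  have "hahn_monom 1 q ^ m = (hahn_monom 1 (of_nat m * q) :: 'k hahn)" for q m
    by (induction m) (simp_all add: one_hahn_def hahn_monom_mult_monom algebra_simps)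
  then show ?thesis using p_gt_1 by (simp add: r_def)
qed

lemma artin_schreier_r: "artin_schreier (r (Suc n)) = r n - r (Suc n)"
  by (simp add: artin_schreier_def r_power)

text \<open>Perfectness gives some p-th root of \<open>r n\<close> in \<open>K\<close>, and p-th
  roots are unique in characteristic p.\<close>

lemma r_mem: "r n \<in> K"
proof (induction n)
  case 0
  show ?case by (simp add: r_0 inverse_mem t_mem)
next
  case (Suc n)
  then obtain y where "y \<in> K" "y ^ CHAR('k) = r (Suc n) ^ CHAR('k)"
    using perfect p_gt_1 by (auto simp: perfect_subfield_def r_power)
  then show ?case using power_char_eq_iff[OF prime_char_hahn, of y "r (Suc n)"] by simp
qed

definition \<alpha>_approx :: "nat \<Rightarrow> 'k hahn" where
  "\<alpha>_approx n = (\<Sum>k=1..n. r k)"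

text \<open>The weights c_k = k - 1 solve c_(k+1) - c_k = 1 with c_1 = 0. By telescoping, the
  Artin-Schreier image is then \<open>\<alpha>_approx n\<close> up to a multiple of
  \<open>r n\<close>.\<close>

definition \<theta>_approx :: "nat \<Rightarrow> 'k hahn" where
  "\<theta>_approx n = (\<Sum>k=1..n. of_nat (k - 1) * r k)"

text \<open>Subtracting r (n + 1) trades the remainder r n for r (n + 1), because the image of r (n
  + 1) is r n - r (n + 1).\<close>

lemma artin_schreier_alpha: "artin_schreier (\<alpha> - \<alpha>_approx n) = r n"
proof (induction n)
  case 0
  show ?case by (simp add: \<alpha>_approx_def alpha r_0)
next
  case (Suc n)
  have "\<alpha> - \<alpha>_approx (Suc n) = (\<alpha> - \<alpha>_approx n) - r (Suc n)"
    by (simp add: \<alpha>_approx_def)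
  then have "artin_schreier (\<alpha> - \<alpha>_approx (Suc n)) =
      artin_schreier (\<alpha> - \<alpha>_approx n) - artin_schreier (r (Suc n))"
    by (simp only: artin_schreier_diff[OF prime_char_hahn, of "\<alpha> - \<alpha>_approx n"])
  then show ?case by (simp add: Suc artin_schreier_r)
qed

text \<open>The extra summand is the end term of the telescoping; it is what distinguishes the
  leading behaviour of \<theta> from that of \<alpha>.\<close>

lemma artin_schreier_theta:
  "artin_schreier (\<theta> - \<theta>_approx n) = (\<alpha> - \<alpha>_approx n) + of_nat n * r n"
proof (induction n)
  case 0
  show ?case by (simp add: \<theta>_approx_def \<alpha>_approx_def theta)
next
  case (Suc n)
  have "\<theta> - \<theta>_approx (Suc n) = (\<theta> - \<theta>_approx n) - of_nat n * r (Suc n)"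
    by (simp add: \<theta>_approx_def)
  then have "artin_schreier (\<theta> - \<theta>_approx (Suc n)) =
      artin_schreier (\<theta> - \<theta>_approx n) - of_nat n * artin_schreier (r (Suc n))"
    by (simp only: artin_schreier_diff[OF prime_char_hahn, of "\<theta> - \<theta>_approx n"]
        artin_schreier_of_nat_mult[OF prime_char_hahn])
  also have "\<dots> = (\<alpha> - \<alpha>_approx n) + of_nat n * r n - of_nat n * (r n - r (Suc n))"
    by (simp only: Suc artin_schreier_r)
  finally have "artin_schreier (\<theta> - \<theta>_approx (Suc n)) =
      (\<alpha> - \<alpha>_approx n) + of_nat n * r n - of_nat n * (r n - r (Suc n))" .
  then show ?case by (simp add: \<alpha>_approx_def algebra_simps)
qed

text \<open>For \<open>n\<close> prime to \<open>CHAR('k)\<close> the term \<open>n r\<^sub>n\<close> of \<open>\<theta>\<close> does not vanish and dominates.\<close>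

lemma hahn_val_theta:
  assumes "\<not> CHAR('k) dvd n"
  shows "hahn_val (\<theta> - \<theta>_approx n) = Fin (- 1 / of_nat (CHAR('k) ^ Suc n))"
proof -
  let ?g = "\<lambda>n. - 1 / of_nat (CHAR('k) ^ n) :: rat"
  have g_less: "?g n < ?g (Suc n)" "?g n < 0" using p_gt_1 by (simp_all add: divide_simps)
  \<comment> \<open>The tail of \<alpha> starts at -1/p^(n+1), strictly above the exponent -1/p^n of
    \<open>of_nat n * r n\<close>.\<close>
  have "hahn_val (\<alpha> - \<alpha>_approx n) = Fin (?g n / of_nat CHAR('k))"
    using hahn_val_monom[of "1 :: 'k" "?g n"] g_less
    by (intro hahn_val_artin_schreier[OF prime_char]) (simp_all add: artin_schreier_alpha r_def)
  then have \<rho>: "hahn_val (\<alpha> - \<alpha>_approx n) = Fin (?g (Suc n))" by simp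
  have n0: "(of_nat n :: 'k) \<noteq> 0" using assms by (simp add: of_nat_eq_0_iff_char_dvd)
  have coeff_n: "hahn_coeff (of_nat n * r n) q = (if q = ?g n then of_nat n else 0)" for q
    by (simp add: of_nat_hahn r_def hahn_monom_mult_monom hahn_monom.rep_eq)
  have "hahn_val ((\<alpha> - \<alpha>_approx n) + of_nat n * r n) = Fin (?g n)"
    using \<rho> n0 g_less(1) unfolding hahn_val_eq_Fin supp_ge_def plus_hahn.rep_eq coeff_n by force
  then have "hahn_val (\<theta> - \<theta>_approx n) = Fin (?g n / of_nat CHAR('k))"
    using g_less by (intro hahn_val_artin_schreier[OF prime_char]) (simp_all add: artin_schreier_theta)
  then show ?thesis by simp
qed

lemma theta_approx_mem: "\<theta>_approx n \<in> K"
  unfolding \<theta>_approx_def by (intro sum_mem mult_mem of_nat_mem r_mem)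

text \<open>\<open>\<theta>_approx n\<close> involves only exponents -1/p^k with k \<le> n, so the
  leading coefficient of the tail is a coefficient of \<theta> itself.\<close>

lemma coeff_theta:
  assumes "\<not> CHAR('k) dvd n"
  shows "hahn_coeff \<theta> (- 1 / of_nat (CHAR('k) ^ Suc n)) \<noteq> 0"
proof -
  let ?g = "\<lambda>n. - 1 / of_nat (CHAR('k) ^ n) :: rat"
  have "hahn_coeff (of_nat (k - 1) * r k) (?g (Suc n)) = 0" if "k \<in> {1..n}" for k
    using that p_gt_1
    by (simp add: of_nat_hahn r_def hahn_monom_mult_monom hahn_monom.rep_eq divide_simps
        flip: power_Suc of_nat_power)
  then have "hahn_coeff (\<theta>_approx n) (?g (Suc n)) = 0"
    unfolding \<theta>_approx_def hahn_coeff_sum by (intro sum.neutral) blast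
  then show ?thesis
    using hahn_val_theta[OF assms] by (simp add: hahn_val_eq_Fin minus_hahn.rep_eq)
qed

lemma theta_notin: "\<theta> \<notin> K"
proof
  assume "\<theta> \<in> K"
  then have fin: "finite {g. real_of_rat g < 0 \<and> hahn_coeff \<theta> g \<noteq> 0}"
    using no_limits unfolding no_finite_limits_def by blast
  \<comment> \<open>Exponents for n = m p + 1, which p never divides, so that
    \<open>coeff_theta\<close> applies to infinitely many of them.\<close>
  define f where "f m = (- 1 / of_nat (CHAR('k) ^ Suc (m * CHAR('k) + 1)) :: rat)" for m
  have "\<not> CHAR('k) dvd m * CHAR('k) + 1" for m
    using p_gt_1 by (metis dvd_add_right_iff dvd_triv_right nat_dvd_1_iff_1 less_irrefl)
  then have "hahn_coeff \<theta> (f m) \<noteq> 0" for m unfolding f_def by (rule coeff_theta)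
  moreover have "real_of_rat (f m) < 0" for m
    using p_gt_1 by (simp only: of_rat_less_0_iff) (simp add: f_def)
  ultimately have "range f \<subseteq> {g. real_of_rat g < 0 \<and> hahn_coeff \<theta> g \<noteq> 0}" by blast
  then have "finite (range f)" using fin finite_subset by blast
  moreover have "inj f"
    using p_gt_1 by (auto simp: inj_def f_def simp flip: power_Suc of_nat_power)
  ultimately show False using finite_imageD infinite_UNIV_nat by blast
qed

lemma theta_approximable:
  assumes "0 < g"
  shows "\<exists>k\<in>K. \<exists>h. hahn_val (\<theta> - k) = Fin h \<and> - g \<le> h"
proof -
  \<comment> \<open>Taking n = m p + 1 keeps n prime to p and at least m, whence p^(n+1) > m >
    1/g.\<close>
  obtain m :: nat where m: "1 / g < of_nat m" using reals_Archimedean2 by blast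
  define n where "n = m * CHAR('k) + 1"
  have "\<not> CHAR('k) dvd n"
    unfolding n_def using p_gt_1 by (metis dvd_add_right_iff dvd_triv_right nat_dvd_1_iff_1 less_irrefl)
  have "m \<le> m * CHAR('k)" using p_gt_1 by simp
  then have "m \<le> n" unfolding n_def by linarith
  also have "n < CHAR('k) ^ n" using p_gt_1 by (simp add: power_gt_expt)
  also have "CHAR('k) ^ n \<le> CHAR('k) ^ Suc n" using p_gt_1 by simp
  finally have "(of_nat m :: rat) \<le> of_nat (CHAR('k) ^ Suc n)" by (simp only: of_nat_le_iff less_imp_le)
  then have "1 / g < of_nat (CHAR('k) ^ Suc n)" using m by linarith
  then have "1 / of_nat (CHAR('k) ^ Suc n) < g" using assms p_gt_1 by (simp only: divide_less_eq) (simp add: field_simps)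
  then show ?thesis
    using hahn_val_theta[OF \<open>\<not> CHAR('k) dvd n\<close>] theta_approx_mem[of n]
    by (intro bexI[of _ "\<theta>_approx n"] exI[of _ "- 1 / of_nat (CHAR('k) ^ Suc n)"]) simp_all
qed

section \<open>The p^2 constant translations of \<theta> and the polynomial they come from\<close>

definition d :: 'k where
  "d = (SOME d. artin_schreier d = 1)"

lemma d: "artin_schreier d = 1"
  unfolding d_def by (rule someI_ex) (metis artin_schreier_surj[OF prime_char])

text \<open>The kernel of the twice iterated Artin-Schreier map: \<open>d\<close> maps to 1, and the
  prime field maps to 0.\<close>

definition E :: "'k hahn set" where
  "E = {of_nat i * hahn_const d + of_nat j | i j. True}"

definition P :: "'k hahn poly" where
  "P = (let f = [:0, 1:] ^ CHAR('k) - [:0, 1:] in f ^ CHAR('k) - f - [:inverse hahn_t:])"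

lemma poly_P: "poly P x = artin_schreier (artin_schreier x) - inverse hahn_t"
  by (simp add: P_def Let_def artin_schreier_def)

lemma degree_P: "degree P = CHAR('k) * CHAR('k)"
proof -
  let ?f = "[:0, 1:] ^ CHAR('k) - [:0, 1:] :: 'k hahn poly"
  have "degree ?f = CHAR('k)" using degree_power_diff[of "CHAR('k)" "[:0, 1 :: 'k hahn:]"] p_gt_1 by simp
  then have "degree (?f ^ CHAR('k) - ?f) = CHAR('k) * CHAR('k)" using degree_power_diff[of "CHAR('k)" ?f] p_gt_1 by simp
  then show ?thesis
    using p_gt_1 degree_diff_const[of "?f ^ CHAR('k) - ?f" "inverse hahn_t"] by (simp add: P_def Let_def)
qed

lemma P_over: "P \<in> polys_over K"
  unfolding P_def Let_def
  by (intro polys_over_diff polys_over_power) (simp_all add: inverse_mem t_mem)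

lemma artin_schreier_E: "artin_schreier (of_nat i * hahn_const d + of_nat j) = (of_nat i :: 'k hahn)"
  by (simp add: artin_schreier_simps artin_schreier_hahn_const d flip: one_hahn_def)

lemma finite_E: "finite E"
proof -
  have mod: "of_nat (i mod CHAR('k)) = (of_nat i :: 'k hahn)" for i
    by (simp add: of_nat_eq_iff_cong_CHAR cong_def)
  have "E \<subseteq> (\<lambda>(i, j). of_nat i * hahn_const d + of_nat j) ` ({..<CHAR('k)} \<times> {..<CHAR('k)})"
  proof
    fix e assume "e \<in> E"
    then obtain i j where "e = of_nat i * hahn_const d + of_nat j" by (auto simp: E_def)
    then show "e \<in> (\<lambda>(i, j). of_nat i * hahn_const d + of_nat j) ` ({..<CHAR('k)} \<times> {..<CHAR('k)})"
      using p_gt_1 by (intro image_eqI[of _ _ "(i mod CHAR('k), j mod CHAR('k))"]) (simp_all add: mod)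
  qed
  then show ?thesis by (rule finite_subset) simp
qed

lemma card_E: "CHAR('k) * CHAR('k) \<le> card E"
proof -
  let ?e = "\<lambda>(i, j). of_nat i * hahn_const d + of_nat j :: 'k hahn"
  have "inj_on ?e ({..<CHAR('k)} \<times> {..<CHAR('k)})"
  proof (rule inj_onI, clarsimp)
    fix i j i' j' assume *: "i < CHAR('k)" "j < CHAR('k)" "i' < CHAR('k)" "j' < CHAR('k)"
      and eq: "of_nat i * hahn_const d + of_nat j = (of_nat i' * hahn_const d + of_nat j' :: 'k hahn)"
    have inj: "a = b" if "of_nat a = (of_nat b :: 'k hahn)" "a < CHAR('k)" "b < CHAR('k)" for a b
      using that inj_on_of_nat_char[where 'a = "'k hahn"] by (auto simp: inj_on_def)
    \<comment> \<open>The Artin-Schreier map kills \<open>j\<close> and sends \<open>d\<close> to 1,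
      so it recovers \<open>i\<close>; then \<open>j\<close> follows by subtraction.\<close>
    have "of_nat i = (of_nat i' :: 'k hahn)"
      using arg_cong[OF eq, of artin_schreier] by (simp only: artin_schreier_E)
    then have "i = i'" using inj * by blast
    then show "i = i' \<and> j = j'" using eq inj * by auto
  qed
  then have "card (?e ` ({..<CHAR('k)} \<times> {..<CHAR('k)})) = CHAR('k) * CHAR('k)" by (simp add: card_image)
  moreover have "?e ` ({..<CHAR('k)} \<times> {..<CHAR('k)}) \<subseteq> E" by (auto simp: E_def)
  ultimately show ?thesis using card_mono[OF finite_E] by metis
qed

text \<open>Both \<theta> and \<sigma> \<theta> are zeros of \<open>P\<close>, so two Artin-Schreier
  steps annihilate their difference; constancy then lifts back through each step.\<close>

lemma aut_diff_const:
  assumes \<sigma>: "\<sigma> \<in> field_auts L K w" and L: "subfield L ring_of_type_algebra" "K \<subseteq> L" "\<theta> \<in> L"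
  shows "\<sigma> \<theta> - \<theta> \<in> range hahn_const"
proof -
  have \<theta>: "poly P \<theta> = 0" by (simp add: poly_P theta alpha)
  have "\<sigma> 0 = 0" using \<sigma> zero_mem by (auto simp: field_auts_def)
  then have "poly P (\<sigma> \<theta>) = 0"
    using field_aut_poly[OF L(1,2) subfield_K \<sigma> L(3) P_over] \<theta> by simp
  then have "artin_schreier (artin_schreier (\<sigma> \<theta> - \<theta>)) = hahn_const 0"
    using \<theta> by (simp add: poly_P artin_schreier_simps hahn_monom_eq_0_iff)
  then have "artin_schreier (artin_schreier (\<sigma> \<theta> - \<theta>)) \<in> range hahn_const" by blast
  then show ?thesis
    by (rule artin_schreier_eq_const_imp[OF prime_char artin_schreier_eq_const_imp[OF prime_char]])
qed

sublocale hahn_translation_extension K \<theta> E P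
proof unfold_locales
  show "finite E" by (rule finite_E)
  show "E \<subseteq> K"
    by (auto simp: E_def intro!: add_mem mult_mem of_nat_mem const_mem)
  have "0 = of_nat 0 * hahn_const d + (of_nat 0 :: 'k hahn)" by simp
  then show "0 \<in> E" unfolding E_def by blast
  show "e + e' \<in> E" if e: "e \<in> E" "e' \<in> E" for e e'
  proof -
    obtain i j i' j' where
      "e = of_nat i * hahn_const d + of_nat j" "e' = of_nat i' * hahn_const d + of_nat j'"
      using e by (auto simp: E_def)
    then have "e + e' = of_nat (i + i') * hahn_const d + of_nat (j + j')" by (simp add: algebra_simps)
    then show ?thesis unfolding E_def by blast
  qed
  show "P \<in> polys_over K" by (rule P_over)
  show "P \<noteq> 0" using degree_P p_gt_1 by auto
  show "degree P \<le> card E" using degree_P card_E by simp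
  show "poly P (\<theta> + e) = 0" if e: "e \<in> E" for e
  proof -
    \<comment> \<open>The first Artin-Schreier step sends \<theta> + e to \<alpha> + i, the second
      sends this to 1/t.\<close>
    obtain i j where "e = of_nat i * hahn_const d + of_nat j" using e by (auto simp: E_def)
    then show ?thesis
      by (simp only: poly_P artin_schreier_add[OF prime_char_hahn, of \<theta>] artin_schreier_E theta
          artin_schreier_add[OF prime_char_hahn, of \<alpha>] alpha artin_schreier_of_nat[OF prime_char_hahn]) simp
  qed
  show "\<theta> \<notin> K" by (rule theta_notin)
  show "hahn_const c \<in> K" for c by (rule const_mem)
  show "hahn_t \<in> K" by (rule t_mem)
  show "henselian hahn_val K" by (rule hensel)
qed

sublocale hahn_translation_extension_char K \<theta> E P
proof unfold_locales
  show "prime CHAR('k)" by (rule prime_char)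
  show "\<sigma> \<theta> - \<theta> \<in> range hahn_const" if "\<sigma> \<in> carrier (gal_group L K)" for \<sigma>
    using aut_diff_const[OF _ subfield_L K_sub_L theta_mem_L] that by (simp add: carrier_gal_group)
  show "\<exists>k\<in>K. \<exists>h. hahn_val (\<theta> - k) = Fin h \<and> - g \<le> h" if "0 < g" for g
    using that by (rule theta_approximable)
qed

end

theorem proposition6p15:
  fixes K M0 :: "'p::prime_card mod_ring alg_closure hahn set"
    and \<alpha> \<theta> :: "'p mod_ring alg_closure hahn"
  assumes "CARD('p) > 2"
    and "subfield K ring_of_type_algebra"
    and "adjoin (range hahn_const) hahn_t \<subseteq> K"
    and "perfect_subfield K"
    and "henselian hahn_val K"
    and "no_finite_limits K"
    and "\<alpha> ^ CARD('p) - \<alpha> = inverse hahn_t"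
    and "\<theta> ^ CARD('p) - \<theta> = \<alpha>"
    and "M0 = adjoin K \<theta>"
  shows "ramification_ideals hahn_val M0 K = {val_max_ideal hahn_val M0}"
proof -
  have char: "CHAR('p mod_ring alg_closure) = CARD('p)" by simp
  interpret artin_schreier_tower K \<alpha> \<theta>
  proof (intro artin_schreier_tower.intro type_subfield.intro artin_schreier_tower_axioms.intro)
    show "subfield K ring_of_type_algebra" "perfect_subfield K" "henselian hahn_val K"
      "no_finite_limits K"
      by (rule assms)+
    show "prime CHAR('p mod_ring alg_closure)" unfolding char by (rule prime_card)
    show "hahn_t \<in> K" "hahn_const c \<in> K" for c
      using adjoin_incl[of hahn_t "range hahn_const"] assms(3) by auto
    show "artin_schreier \<alpha> = inverse hahn_t" "artin_schreier \<theta> = \<alpha>"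
      using assms(7,8) by (simp_all add: artin_schreier_def)
  qed
  show ?thesis
    using ramification_ideals_eq unfolding assms(9) adjoin_eq_L .
qed

end
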